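(* Let $n\ge 5$ be an integer. Then there exists (a) a POTB with two $n$-level factors on $2n$ blocks of size $2$ each, and (b) a POTB with four $n$-level factors on $4n$ blocks of size $2$ each. (c) In the case $n=5$ of (a) one gets a balanced POTB, i.e. there exists a balanced POTB with two $5$-level factors on $10$ blocks of size $2$ each. Further, in the case $n=10$ of (b) one gets a POTB which is E-optimal for the inference on each factor, i.e. there exists a POTB with four $10$-level factors on $40$ blocks of size $2$ each that is E-optimal for the inference on each of its four factors.
   Context: Let $b,k,m\ge 1$ be integers. A blocked main effect plan (MEP) with $m$ factors $F_1,\dots,F_m$ on $b$ blocks of size $k$ each is an $(m+1)\times bk$ array, with rows indexed $0,1,\dots,m$. The entries of row $0$ (the block factor $B$) lie in $\{1,\dots,b\}$ and each $j\in\{1,\dots,b\}$ appears exactly $k$ times in row $0$. For $1\le i\le m$ the entries of row $i$ lie in a set $S_i$ of size $s_i$, and $F_i$ is said to have $s_i$ levels (the elements of $S_i$). Each column is a run (plot); columns with entry $j$ in row $0$ form the $j$th block. Columns may be repeated. For $1\le i,j\le m$, $M_{ij}$ is the $s_i\times s_j$ matrix whose $(p,q)$ entry is the number of columns whose $i$th entry is $p$ and $j$th entry is $q$ ($p\in S_i,q\in S_j$). $M_{iB}$ is the $s_i\times b$ matrix whose $(p,j)$ entry is the number of columns whose $i$th entry is $p$ and whose row-$0$ entry is $j$. Factors $F_i,F_j$ ($i\ne j$) are orthogonal through the block factor if $M_{iB}(M_{jB})'=k\,M_{ij}$ (prime denotes transpose). A POTB (plan orthogonal through the block factor) is a blocked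 MEP in which every pair of distinct factors is orthogonal through the block factor. A blocked MEP is connected if, for each $i$, $M_{iB}$ is the incidence matrix of a connected block design, i.e. the graph on $S_i$ in which two levels are adjacent when some block contains both is connected. A connected POTB is balanced if for each $i$, $M_{iB}$ is the treatment-versus-block incidence matrix of a balanced incomplete block design (BIBD). E-optimality: the standard additive fixed-effects model is assumed, in which the response of a run in block $j$ with levels $(x_1,\dots,x_m)$ has mean $\mu+\beta_j+\sum_{i}\tau^{(i)}_{x_i}$, with uncorrelated errors of equal variance. For a blocked MEP $\rho$, let $X_i$ be the $bk\times s_i$ $0/1$ matrix of runs versus levels of $F_i$ and $X_B$ the $bk\times b$ $0/1$ matrix of runs versus blocks. The information matrix for $F_i$ is $C_i(\rho)=X_i'(I-P)X_i$, where $P$ is the orthogonal projection onto the span of the columns of $X_B$ and of all $X_j$ with $j\ne i$. A connected plan $\rho^*$ is E-optimal for the inference on $F_i$ if, among all connected blocked MEPs $\rho$ in the same set-up (same number of factors, same numbers of levels, same number $b$ of blocks, same block size $k$), it maximizes the smallest eigenvalue of $C_i(\rho)$ restricted to the orthogonal complement of the all-one vector. *)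

theory Defs
  imports
    "HOL.Real"
    "Jordan_Normal_Form.Char_Poly"
    "Jordan_Normal_Form.VS_Connect"
begin

text \<open>
  A plan is an \<open>(m + 1) \<times> b k\<close> array over \<open>nat\<close>: row \<open>0\<close> is the block factor, row \<open>i\<close> the
  \<open>i\<close>-th factor, and each column a run. As matrix indices start at \<open>0\<close>, blocks are labelled
  \<open>0, \<dots>, b - 1\<close> and the level set of the \<open>i\<close>-th factor is \<open>{0, \<dots>, s i - 1}\<close>; only the values
  \<open>s 1, \<dots>, s m\<close> matter.
\<close>

definition blocked_mep :: "nat \<Rightarrow> (nat \<Rightarrow> nat) \<Rightarrow> nat \<Rightarrow> nat \<Rightarrow> nat mat \<Rightarrow> bool" where
  "blocked_mep m s b k A \<longleftrightarrow>
     1 \<le> m \<and> 1 \<le> b \<and> 1 \<le> k \<and>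
     A \<in> carrier_mat (m + 1) (b * k) \<and>
     (\<forall>c < b * k. A $$ (0, c) < b) \<and>
     (\<forall>j < b. card {c. c < b * k \<and> A $$ (0, c) = j} = k) \<and>
     (\<forall>i \<in> {1..m}. \<forall>c < b * k. A $$ (i, c) < s i)"

text \<open>
  \<open>count_mat A i p j q\<close> counts the runs by their entries in rows \<open>i\<close> and \<open>j\<close>, with \<open>p\<close> and \<open>q\<close>
  possible entries in these rows.
\<close>

definition count_mat :: "nat mat \<Rightarrow> nat \<Rightarrow> nat \<Rightarrow> nat \<Rightarrow> nat \<Rightarrow> nat mat" where
  "count_mat A i p j q =
     mat p q (\<lambda>(x, y). card {c. c < dim_col A \<and> A $$ (i, c) = x \<and> A $$ (j, c) = y})"

definition factor_mat :: "(nat \<Rightarrow> nat) \<Rightarrow> nat mat \<Rightarrow> nat \<Rightarrow> nat \<Rightarrow> nat mat" where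
  "factor_mat s A i j = count_mat A i (s i) j (s j)"

definition block_mat :: "(nat \<Rightarrow> nat) \<Rightarrow> nat \<Rightarrow> nat mat \<Rightarrow> nat \<Rightarrow> nat mat" where
  "block_mat s b A i = count_mat A i (s i) 0 b"

definition orthogonal_through_block ::
    "(nat \<Rightarrow> nat) \<Rightarrow> nat \<Rightarrow> nat \<Rightarrow> nat mat \<Rightarrow> nat \<Rightarrow> nat \<Rightarrow> bool" where
  "orthogonal_through_block s b k A i j \<longleftrightarrow>
     block_mat s b A i * transpose_mat (block_mat s b A j) = k \<cdot>\<^sub>m factor_mat s A i j"

definition potb :: "nat \<Rightarrow> (nat \<Rightarrow> nat) \<Rightarrow> nat \<Rightarrow> nat \<Rightarrow> nat mat \<Rightarrow> bool" where
  "potb m s b k A \<longleftrightarrow>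
     blocked_mep m s b k A \<and>
     (\<forall>i \<in> {1..m}. \<forall>j \<in> {1..m}. i \<noteq> j \<longrightarrow> orthogonal_through_block s b k A i j)"

definition level_adjacency :: "nat mat \<Rightarrow> (nat \<times> nat) set" where
  "level_adjacency N =
     {(p, q). p < dim_row N \<and> q < dim_row N \<and> p \<noteq> q \<and>
        (\<exists>j < dim_col N. N $$ (p, j) > 0 \<and> N $$ (q, j) > 0)}"

definition connected_design :: "nat mat \<Rightarrow> bool" where
  "connected_design N \<longleftrightarrow>
     (\<forall>p < dim_row N. \<forall>q < dim_row N. (p, q) \<in> (level_adjacency N)\<^sup>*)"

definition connected_mep :: "nat \<Rightarrow> (nat \<Rightarrow> nat) \<Rightarrow> nat \<Rightarrow> nat \<Rightarrow> nat mat \<Rightarrow> bool" where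
  "connected_mep m s b k A \<longleftrightarrow>
     blocked_mep m s b k A \<and> (\<forall>i \<in> {1..m}. connected_design (block_mat s b A i))"

text \<open>Treatments are rows and blocks are columns; \<open>k\<close> is the block size.\<close>

definition bibd_incidence :: "nat \<Rightarrow> nat mat \<Rightarrow> bool" where
  "bibd_incidence k N \<longleftrightarrow>
     2 \<le> k \<and> k < dim_row N \<and>
     (\<forall>p < dim_row N. \<forall>j < dim_col N. N $$ (p, j) \<in> {0, 1}) \<and>
     (\<forall>j < dim_col N. (\<Sum>p < dim_row N. N $$ (p, j)) = k) \<and>
     (\<exists>r. \<forall>p < dim_row N. (\<Sum>j < dim_col N. N $$ (p, j)) = r) \<and>
     (\<exists>l > 0. \<forall>p < dim_row N. \<forall>q < dim_row N. p \<noteq> q \<longrightarrow>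
        card {j. j < dim_col N \<and> N $$ (p, j) = 1 \<and> N $$ (q, j) = 1} = l)"

definition balanced_potb :: "nat \<Rightarrow> (nat \<Rightarrow> nat) \<Rightarrow> nat \<Rightarrow> nat \<Rightarrow> nat mat \<Rightarrow> bool" where
  "balanced_potb m s b k A \<longleftrightarrow>
     potb m s b k A \<and> connected_mep m s b k A \<and>
     (\<forall>i \<in> {1..m}. bibd_incidence k (block_mat s b A i))"

text \<open>The \<open>0/1\<close> matrix of runs versus the \<open>p\<close> possible entries of row \<open>i\<close>.\<close>

definition design_mat :: "nat mat \<Rightarrow> nat \<Rightarrow> nat \<Rightarrow> real mat" where
  "design_mat A i p = mat (dim_col A) p (\<lambda>(c, x). if A $$ (i, c) = x then 1 else 0)"

definition vec_span :: "nat \<Rightarrow> real vec set \<Rightarrow> real vec set" where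
  "vec_span N S = LinearCombinations.module.span class_ring (module_vec TYPE(real) N) S"

definition orth_proj :: "nat \<Rightarrow> real vec set \<Rightarrow> real mat" where
  "orth_proj N W =
     (THE P. P \<in> carrier_mat N N \<and>
        (\<forall>y \<in> carrier_vec N. P *\<^sub>v y \<in> W \<and> (\<forall>w \<in> W. w \<bullet> (y - P *\<^sub>v y) = 0)))"

definition nuisance_space :: "nat \<Rightarrow> (nat \<Rightarrow> nat) \<Rightarrow> nat \<Rightarrow> nat mat \<Rightarrow> nat \<Rightarrow> real vec set" where
  "nuisance_space m s b A i =
     vec_span (dim_col A)
       (set (cols (design_mat A 0 b)) \<union> (\<Union>j \<in> {1..m} - {i}. set (cols (design_mat A j (s j)))))"

definition information_mat :: "nat \<Rightarrow> (nat \<Rightarrow> nat) \<Rightarrow> nat \<Rightarrow> nat mat \<Rightarrow> nat \<Rightarrow> real mat" where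
  "information_mat m s b A i =
     transpose_mat (design_mat A i (s i)) *
       (1\<^sub>m (dim_col A) - orth_proj (dim_col A) (nuisance_space m s b A i)) *
       design_mat A i (s i)"

text \<open>
  The all-one vector lies in the kernel of an information matrix \<open>C\<close>, so \<open>C\<close> maps its orthogonal
  complement to itself; the eigenvalues of this restriction are those eigenvalues of \<open>C\<close> that have
  an eigenvector orthogonal to the all-one vector. There is none if \<open>C\<close> is \<open>1 \<times> 1\<close>.
\<close>

definition smallest_contrast_eigenvalue :: "real mat \<Rightarrow> real" where
  "smallest_contrast_eigenvalue C =
     Min {e. \<exists>v. eigenvector C v e \<and> v \<bullet> vec (dim_row C) (\<lambda>_. 1) = 0}"

definition E_optimal :: "nat \<Rightarrow> (nat \<Rightarrow> nat) \<Rightarrow> nat \<Rightarrow> nat \<Rightarrow> nat mat \<Rightarrow> nat \<Rightarrow> bool" where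
  "E_optimal m s b k A i \<longleftrightarrow>
     connected_mep m s b k A \<and>
     (\<forall>R. connected_mep m s b k R \<longrightarrow>
        smallest_contrast_eigenvalue (information_mat m s b R i)
          \<le> smallest_contrast_eigenvalue (information_mat m s b A i))"

end

theory Submission
  imports Defs "HOL-Analysis.Function_Topology" "HOL-Number_Theory.Cong" "Jordan_Normal_Form.Spectral_Radius"
begin

text \<open>
  \<^bold>\<open>Construction.\<close> With blocks of size two, a block with runs \<open>a\<close> and \<open>c\<close> contributes
  to \<open>M\<^sub>i\<^sub>B M\<^sub>j\<^sub>B'\<close> once for each of the pairs \<open>(a\<^sub>i, a\<^sub>j)\<close>, \<open>(c\<^sub>i, c\<^sub>j)\<close>, \<open>(a\<^sub>i, c\<^sub>j)\<close>, \<open>(c\<^sub>i, a\<^sub>j)\<close> of levels. The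
  first two add up to \<open>M\<^sub>i\<^sub>j\<close> over the blocks, so orthogonality through the blocks, with \<open>2 M\<^sub>i\<^sub>j\<close> on the
  right, says that the swapped pairs have the same distribution as the pairs in the runs
  (\<open>two_run_plan_orthogonal\<close>). If a few initial blocks are developed modulo \<open>n\<close>, only the
  differences \<open>a\<^sub>j - a\<^sub>i\<close>, \<open>c\<^sub>j - c\<^sub>i\<close> and \<open>c\<^sub>j - a\<^sub>i\<close>, \<open>a\<^sub>j - c\<^sub>i\<close> matter. Write \<open>a = \<mu> - \<delta>/2\<close> and
  \<open>c = \<mu> + \<delta>/2\<close>, with the differences \<open>\<mu>\<^sub>j - \<mu>\<^sub>i\<close> the same in all initial blocks: up to this constant and
  the factor one half, the former are \<open>\<plusminus>(\<delta>\<^sub>j - \<delta>\<^sub>i)\<close> and the latter \<open>\<plusminus>(\<delta>\<^sub>j + \<delta>\<^sub>i)\<close>. The vectors \<open>\<delta>\<close> are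
  taken as the rows of the quaternionic orthogonal design on \<open>1, 2, 3, 4\<close>. In any two of its columns
  the rows come in pairs \<open>(x, y)\<close>, \<open>\<plusminus>(y, -x)\<close>, and passing from one to the other exchanges sums and
  differences up to sign. The leading \<open>2 \<times> 2\<close> block of the design has the same property and gives
  the plan with two factors.

  \<^bold>\<open>Balance.\<close> Each factor of the two-factor plan has differences \<open>\<plusminus>1\<close> and \<open>\<plusminus>2\<close>, which for \<open>n = 5\<close> are
  all nonzero residues, each once: every pair of levels meets in exactly one block.

  \<^bold>\<open>E-optimality.\<close> The form \<open>x' C\<^sub>i x\<close> is the squared distance of \<open>X\<^sub>i x\<close> from the nuisance space
  (\<open>information_quadratic_form\<close>), so it is at most the squared distance from any vector of that space, such
  as the block averages. For a plan that is orthogonal through the blocks the residuals from the block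
  averages are orthogonal to the other factors, and the bound is attained (\<open>potb_information_form\<close>).
  For block size two the sum of squares within blocks is \<open>\<Sum> (x\<^sub>p - x\<^sub>q)\<^sup>2 / 2\<close> over the blocks, half the
  Laplacian form of a multigraph on the levels whose edges are the blocks. It is therefore enough to
  compare Laplacians of multigraphs with \<open>40\<close> edges on \<open>10\<close> vertices. Such a graph has a vertex of
  degree at most \<open>7\<close> or is \<open>8\<close>-regular with two nonadjacent vertices; a suitable contrast then has
  Rayleigh quotient at most \<open>8\<close> (\<open>edges_with_small_variation\<close>). The plan for \<open>n = 10\<close> realizes the
  differences \<open>\<plusminus>1, \<plusminus>2, \<plusminus>3, \<plusminus>4\<close> once each, that is, the complete graph without the perfect matching
  of antipodal levels, and its Laplacian form is at least \<open>8\<close> times the squared norm on all contrasts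
  (\<open>shift_variation_1234\<close>). The smallest eigenvalue on contrasts is tied to these Rayleigh quotients by
  the existence of a minimizer, which is an eigenvector (\<open>minimal_contrast_eigenpair\<close>).
\<close>

section \<open>Orthogonal projections onto spans of vectors\<close>

lemma vec_span_carrier: "S \<subseteq> carrier_vec N \<Longrightarrow> vec_span N S \<subseteq> carrier_vec N"
proof -
  interpret vec_space "TYPE(real)" N .
  show "S \<subseteq> carrier_vec N \<Longrightarrow> ?thesis" unfolding vec_span_def by (rule span_is_subset2)
qed

lemma vec_span_superset: "S \<subseteq> carrier_vec N \<Longrightarrow> S \<subseteq> vec_span N S"
proof -
  interpret vec_space "TYPE(real)" N .
  show "S \<subseteq> carrier_vec N \<Longrightarrow> ?thesis" unfolding vec_span_def by (rule in_own_span)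
qed

lemma vec_span_mono: "S \<subseteq> T \<Longrightarrow> vec_span N S \<subseteq> vec_span N T"
proof -
  interpret vec_space "TYPE(real)" N .
  show "S \<subseteq> T \<Longrightarrow> ?thesis" unfolding vec_span_def by (rule span_is_monotone)
qed

lemma vec_span_zero: "0\<^sub>v N \<in> vec_span N S"
proof -
  interpret vec_space "TYPE(real)" N .
  show ?thesis unfolding vec_span_def using span_zero by simp
qed

lemma vec_span_add:
  assumes "S \<subseteq> carrier_vec N" "v \<in> vec_span N S" "w \<in> vec_span N S"
  shows "v + w \<in> vec_span N S"
proof -
  interpret vec_space "TYPE(real)" N .
  show ?thesis using assms unfolding vec_span_def by (rule span_add1)
qed

lemma vec_span_smult:
  assumes "S \<subseteq> carrier_vec N" "v \<in> vec_span N S"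
  shows "c \<cdot>\<^sub>v v \<in> vec_span N S"
proof -
  interpret vec_space "TYPE(real)" N .
  show ?thesis using assms unfolding vec_span_def by (rule smult_in_span)
qed

lemma vec_span_diff:
  assumes S: "S \<subseteq> carrier_vec N" and "v \<in> vec_span N S" "w \<in> vec_span N S"
  shows "v - w \<in> vec_span N S"
proof -
  have "v \<in> carrier_vec N" "w \<in> carrier_vec N"
    using assms vec_span_carrier by auto
  hence "v - w = v + (- 1) \<cdot>\<^sub>v w" by (intro eq_vecI) auto
  thus ?thesis using assms by (simp add: vec_span_add vec_span_smult)
qed

lemma orthogonal_to_vec_span:
  assumes S: "S \<subseteq> carrier_vec N" and r: "r \<in> carrier_vec N" and "\<And>s. s \<in> S \<Longrightarrow> r \<bullet> s = 0"
    and w: "w \<in> vec_span N S"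
  shows "w \<bullet> r = 0"
proof -
  interpret vec_space "TYPE(real)" N .
  have "r \<in> orthogonal_complement S" using assms by (simp add: orthogonal_complement_def)
  hence "r \<in> orthogonal_complement (span S)" using S by simp
  hence "r \<bullet> w = 0" using w by (simp add: orthogonal_complement_def vec_span_def)
  thus ?thesis using r w vec_span_carrier[OF S] by (subst comm_scalar_prod[of _ N]) auto
qed

lemma scalar_prod_self_eq_0:
  fixes v :: "real vec"
  assumes "v \<bullet> v = 0" "v \<in> carrier_vec N"
  shows "v = 0\<^sub>v N"
  using conjugate_square_eq_0_vec[OF assms(2)] assms(1) by simp

lemma scalar_prod_self_nonneg: "0 \<le> v \<bullet> (v :: real vec)"
  by (simp add: scalar_prod_def sum_nonneg)

definition is_orth_proj :: "nat \<Rightarrow> real vec set \<Rightarrow> real mat \<Rightarrow> bool" where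
  "is_orth_proj N W P \<longleftrightarrow> P \<in> carrier_mat N N \<and>
     (\<forall>y \<in> carrier_vec N. P *\<^sub>v y \<in> W \<and> (\<forall>w \<in> W. w \<bullet> (y - P *\<^sub>v y) = 0))"

lemma orthogonal_decomposition_unique:
  assumes S: "S \<subseteq> carrier_vec N" and y: "y \<in> carrier_vec N"
    and p: "p \<in> vec_span N S" "\<And>w. w \<in> vec_span N S \<Longrightarrow> w \<bullet> (y - p) = 0"
    and q: "q \<in> vec_span N S" "\<And>w. w \<in> vec_span N S \<Longrightarrow> w \<bullet> (y - q) = 0"
  shows "p = q"
proof -
  have pq: "p \<in> carrier_vec N" "q \<in> carrier_vec N"
    using p q vec_span_carrier[OF S] by auto
  have w: "p - q \<in> vec_span N S" using S p q by (simp add: vec_span_diff)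
  have "(p - q) \<bullet> (p - q) = (p - q) \<bullet> ((y - q) - (y - p))"
    using pq y by (intro arg_cong2[of _ _ _ _ scalar_prod] eq_vecI) auto
  also have "\<dots> = (p - q) \<bullet> (y - q) - (p - q) \<bullet> (y - p)"
    using pq y by (intro scalar_prod_minus_distrib[of _ N]) auto
  finally have "(p - q) \<bullet> (p - q) = 0" using p(2)[OF w] q(2)[OF w] by simp
  hence "p - q = 0\<^sub>v N" using pq scalar_prod_self_eq_0 by simp
  hence "(p - q) $ i = 0" if "i < N" for i using that by simp
  thus ?thesis using pq by (intro eq_vecI) auto
qed

lemma is_orth_proj_unique:
  assumes S: "S \<subseteq> carrier_vec N"
    and P: "is_orth_proj N (vec_span N S) P" and Q: "is_orth_proj N (vec_span N S) Q"
  shows "P = Q"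
proof (rule eq_matI)
  show "dim_row P = dim_row Q" "dim_col P = dim_col Q"
    using P Q by (auto simp: is_orth_proj_def)
  fix i j assume "i < dim_row Q" "j < dim_col Q"
  hence ij: "i < N" "j < N" using Q by (auto simp: is_orth_proj_def)
  have "P *\<^sub>v unit_vec N j = Q *\<^sub>v unit_vec N j"
    using P Q by (intro orthogonal_decomposition_unique[OF S, of "unit_vec N j"])
      (auto simp: is_orth_proj_def)
  hence "(P *\<^sub>v unit_vec N j) $ i = (Q *\<^sub>v unit_vec N j) $ i" by simp
  thus "P $$ (i, j) = Q $$ (i, j)" using ij P Q by (auto simp: is_orth_proj_def)
qed

text \<open>
  One step of Gram-Schmidt orthogonalization: when \<open>u\<close> is added to the generators, the projection
  changes by the rank-one projection onto the line of \<open>u' = u - P u\<close>. If \<open>u' = 0\<close>, the quotient by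
  \<open>u' \<bullet> u'\<close> has the value \<open>0\<close>, and the projection correctly stays the same.
\<close>

lemma is_orth_proj_exists:
  assumes "finite S" "S \<subseteq> carrier_vec N"
  shows "\<exists>P. is_orth_proj N (vec_span N S) P"
  using assms
proof (induction S)
  case empty
  have "is_orth_proj N (vec_span N {}) (0\<^sub>m N N)"
    unfolding is_orth_proj_def
  proof (intro conjI ballI)
    fix y :: "real vec" and w assume y: "y \<in> carrier_vec N" 
    have zero: "0\<^sub>m N N *\<^sub>v y = 0\<^sub>v N" using y by (intro eq_vecI) auto
    thus "0\<^sub>m N N *\<^sub>v y \<in> vec_span N {}" using vec_span_zero by simp
    assume w: "w \<in> vec_span N {}"
    show "w \<bullet> (y - 0\<^sub>m N N *\<^sub>v y) = 0"
      using y zero by (intro orthogonal_to_vec_span[OF _ _ _ w]) auto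
  qed auto
  thus ?case ..
next
  case (insert u S)
  let ?W = "vec_span N S" and ?W' = "vec_span N (insert u S)"
  have S: "S \<subseteq> carrier_vec N" and u: "u \<in> carrier_vec N" using insert by auto
  have S': "insert u S \<subseteq> carrier_vec N" using S u by simp
  have WW': "?W \<subseteq> ?W'" by (rule vec_span_mono) auto
  obtain P where P: "P \<in> carrier_mat N N"
    and PW: "\<And>y. y \<in> carrier_vec N \<Longrightarrow> P *\<^sub>v y \<in> ?W"
    and Po: "\<And>y w. y \<in> carrier_vec N \<Longrightarrow> w \<in> ?W \<Longrightarrow> w \<bullet> (y - P *\<^sub>v y) = 0"
    using insert by (auto simp: is_orth_proj_def)
  have Pc: "P *\<^sub>v y \<in> carrier_vec N" for y using P by (intro carrier_vecI) simp
  define u' where "u' = u - P *\<^sub>v u"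
  have u': "u' \<in> carrier_vec N" using u Pc by (simp add: u'_def)
  have uW': "u \<in> ?W'" using vec_span_superset[OF S'] by auto
  have u'W: "u' \<in> ?W'" unfolding u'_def using S' uW' PW[OF u] WW' by (auto intro: vec_span_diff)
  define Q where "Q = P + mat N N (\<lambda>(i, j). u' $ i * u' $ j / (u' \<bullet> u'))"
  have Q: "Q \<in> carrier_mat N N" using P by (simp add: Q_def)
  have Qy: "Q *\<^sub>v y = P *\<^sub>v y + (u' \<bullet> y / (u' \<bullet> u')) \<cdot>\<^sub>v u'" if y: "y \<in> carrier_vec N" for y
  proof -
    have "mat N N (\<lambda>(i, j). u' $ i * u' $ j / (u' \<bullet> u')) *\<^sub>v y = (u' \<bullet> y / (u' \<bullet> u')) \<cdot>\<^sub>v u'"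
    proof (rule eq_vecI)
      fix i assume "i < dim_vec ((u' \<bullet> y / (u' \<bullet> u')) \<cdot>\<^sub>v u')"
      hence i: "i < N" using u' by simp
      have "(mat N N (\<lambda>(i, j). u' $ i * u' $ j / (u' \<bullet> u')) *\<^sub>v y) $ i
          = (\<Sum>j<N. u' $ i * u' $ j / (u' \<bullet> u') * y $ j)"
        using i y by (simp add: scalar_prod_def atLeast0LessThan)
      also have "\<dots> = ((u' \<bullet> y / (u' \<bullet> u')) \<cdot>\<^sub>v u') $ i"
      proof -
        have "u' \<bullet> y = (\<Sum>j<N. u' $ j * y $ j)" using y by (simp add: scalar_prod_def atLeast0LessThan)
        thus ?thesis using i u' by (simp add: sum_divide_distrib sum_distrib_left sum_distrib_right mult_ac)
      qed
      finally show "(mat N N (\<lambda>(i, j). u' $ i * u' $ j / (u' \<bullet> u')) *\<^sub>v y) $ i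
        = ((u' \<bullet> y / (u' \<bullet> u')) \<cdot>\<^sub>v u') $ i" .
    qed (use u' in auto)
    thus ?thesis unfolding Q_def using P y by (subst add_mult_distrib_mat_vec[of _ N N]) auto
  qed
  have "is_orth_proj N ?W' Q"
    unfolding is_orth_proj_def
  proof (intro conjI ballI)
    show "Q \<in> carrier_mat N N" by (rule Q)
    fix y :: "real vec" assume y: "y \<in> carrier_vec N"
    let ?c = "u' \<bullet> y / (u' \<bullet> u')"
    show "Q *\<^sub>v y \<in> ?W'"
      unfolding Qy[OF y] using PW[OF y] WW' u'W S' by (auto intro!: vec_span_add vec_span_smult)
    fix w assume w: "w \<in> ?W'"
    let ?r = "y - Q *\<^sub>v y"
    have r: "?r \<in> carrier_vec N" using y Q by auto
    have r_eq: "?r = (y - P *\<^sub>v y) - ?c \<cdot>\<^sub>v u'"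
      unfolding Qy[OF y] using y u' P by (intro eq_vecI) auto
    have yP: "y - P *\<^sub>v y \<in> carrier_vec N" using y Pc by simp
    \<comment> \<open>The residual is orthogonal to the old span and to \<open>u\'\<close>, hence to \<open>u = u\' + P u\<close>.\<close>
    have rW: "?r \<bullet> s = 0" if s: "s \<in> ?W" for s
    proof -
      have sc: "s \<in> carrier_vec N" using s vec_span_carrier[OF S] by auto
      have "s \<bullet> ?r = s \<bullet> (y - P *\<^sub>v y) - ?c * (s \<bullet> u')"
        unfolding r_eq using sc yP u' by (simp add: scalar_prod_minus_distrib[of _ N])
      also have "\<dots> = 0" using Po[OF y s] Po[OF u s] by (simp add: u'_def)
      finally show ?thesis using sc r by (simp add: comm_scalar_prod[of _ N])
    qed
    have ru': "?r \<bullet> u' = 0"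
    proof -
      have "?r \<bullet> u' = u' \<bullet> ?r" using u' r by (rule comm_scalar_prod[symmetric])
      also have "\<dots> = u' \<bullet> (y - P *\<^sub>v y) - ?c * (u' \<bullet> u')"
        unfolding r_eq using yP u' by (simp add: scalar_prod_minus_distrib[of _ N])
      also have "u' \<bullet> (y - P *\<^sub>v y) = u' \<bullet> y - u' \<bullet> (P *\<^sub>v y)"
        using u' y Pc by (simp add: scalar_prod_minus_distrib[of _ N])
      also have "u' \<bullet> (P *\<^sub>v y) = (P *\<^sub>v y) \<bullet> u'" using u' Pc by (rule comm_scalar_prod)
      also have "\<dots> = 0" unfolding u'_def using Po[OF u PW[OF y]] .
      finally show ?thesis using scalar_prod_self_eq_0[OF _ u'] y u' by (cases "u' \<bullet> u' = 0") auto
    qed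
    have "u = u' + P *\<^sub>v u" using u P by (intro eq_vecI) (auto simp: u'_def)
    hence "?r \<bullet> u = ?r \<bullet> (u' + P *\<^sub>v u)" by simp
    also have "\<dots> = ?r \<bullet> u' + ?r \<bullet> (P *\<^sub>v u)"
      using r u' Pc by (rule scalar_prod_add_distrib)
    also have "\<dots> = 0" using ru' rW[OF PW[OF u]] by simp
    finally have "?r \<bullet> u = 0" .
    moreover have "?r \<bullet> s = 0" if "s \<in> S" for s
      using that rW vec_span_superset[OF S] by auto
    ultimately show "w \<bullet> ?r = 0" by (intro orthogonal_to_vec_span[OF S' r _ w]) auto
  qed
  thus ?case ..
qed

lemma orth_proj_is_orth_proj:
  assumes "finite S" "S \<subseteq> carrier_vec N"
  shows "is_orth_proj N (vec_span N S) (orth_proj N (vec_span N S))"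
proof -
  obtain P where P: "is_orth_proj N (vec_span N S) P" using is_orth_proj_exists[OF assms] ..
  have "orth_proj N (vec_span N S) = (THE P. is_orth_proj N (vec_span N S) P)"
    by (simp add: orth_proj_def is_orth_proj_def)
  also have "\<dots> = P" using P is_orth_proj_unique[OF assms(2)] by (intro the_equality) auto
  finally show ?thesis using P by simp
qed

text \<open>
  Both factors may be projected because \<open>x - P x\<close> is orthogonal to \<open>P y\<close>; as the right-hand side is
  symmetric in \<open>x\<close> and \<open>y\<close>, the projection is self-adjoint.
\<close>

lemma is_orth_proj_self_adjoint:
  assumes S: "S \<subseteq> carrier_vec N" and P: "is_orth_proj N (vec_span N S) P"
    and x: "x \<in> carrier_vec N" and y: "y \<in> carrier_vec N"
  shows "x \<bullet> (P *\<^sub>v y) = (P *\<^sub>v x) \<bullet> (P *\<^sub>v y)"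
proof -
  have Pc: "P *\<^sub>v z \<in> carrier_vec N" for z
    using P by (intro carrier_vecI) (auto simp: is_orth_proj_def)
  have "(P *\<^sub>v y) \<bullet> (x - P *\<^sub>v x) = 0" using P x y by (auto simp: is_orth_proj_def)
  hence "(P *\<^sub>v y) \<bullet> x = (P *\<^sub>v y) \<bullet> (P *\<^sub>v x)"
    using x Pc by (simp add: scalar_prod_minus_distrib[of _ N])
  thus ?thesis using x Pc by (simp add: comm_scalar_prod[of _ N])
qed

section \<open>The smallest eigenvalue on contrasts\<close>

text \<open>
  The unit sphere of the space of contrasts is a closed subset of a product of compact intervals, so
  the quadratic form attains its minimum on it; homogeneity extends the bound to all contrasts.
  Vectors are functions on \<open>nat\<close> so that the product topology is available for a dimension \<open>n\<close> that
  is not a type; the coordinates from \<open>n\<close> on, too, are confined to \<open>[-1, 1]\<close> for the sake of compactness.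
\<close>

lemma rayleigh_minimizer_exists:
  fixes M :: "nat \<Rightarrow> nat \<Rightarrow> real" and x :: "nat \<Rightarrow> real"
  assumes x0: "(\<Sum>i<n. x i) = 0" and x1: "(\<Sum>i<n. (x i)\<^sup>2) > 0"
  shows "\<exists>y. (\<Sum>i<n. y i) = 0 \<and> (\<Sum>i<n. (y i)\<^sup>2) = 1 \<and>
    (\<forall>z. (\<Sum>i<n. z i) = 0 \<longrightarrow>
      (\<Sum>i<n. \<Sum>j<n. y i * M i j * y j) * (\<Sum>i<n. (z i)\<^sup>2) \<le> (\<Sum>i<n. \<Sum>j<n. z i * M i j * z j))"
proof -
  define q where "q z = (\<Sum>i<n. \<Sum>j<n. z i * M i j * z j)" for z :: "nat \<Rightarrow> real"
  define B where "B = (UNIV :: nat set) \<rightarrow>\<^sub>E {-1..1::real}"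
  define K where "K = B \<inter> {y. (\<Sum>i<n. y i) = 0} \<inter> {y. (\<Sum>i<n. (y i)\<^sup>2) = 1}"
  have coord: "continuous_on UNIV (\<lambda>y :: nat \<Rightarrow> real. y i)" for i
    by (rule continuous_on_product_coordinates)
  have "compact B"
    using compactin_PiE[of "\<lambda>_ :: nat. euclidean :: real topology" UNIV "\<lambda>_. {-1..1}"]
    by (simp add: B_def euclidean_product_topology)
  moreover have "closed {y :: nat \<Rightarrow> real. (\<Sum>i<n. y i) = 0}" "closed {y :: nat \<Rightarrow> real. (\<Sum>i<n. (y i)\<^sup>2) = 1}"
    by (intro closed_Collect_eq continuous_intros coord)+
  ultimately have K: "compact K" unfolding K_def by (intro compact_Int_closed)
  have scaled: "\<exists>y\<in>K. (\<Sum>i<n. (z i)\<^sup>2) * q y = q z"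
    if z0: "(\<Sum>i<n. z i) = 0" and z1: "(\<Sum>i<n. (z i)\<^sup>2) > 0" for z
  proof -
    define s where "s = sqrt (\<Sum>i<n. (z i)\<^sup>2)"
    have s: "s > 0" "s\<^sup>2 = (\<Sum>i<n. (z i)\<^sup>2)" using z1 by (auto simp: s_def)
    define y where "y i = (if i < n then z i / s else 0)" for i
    have "(\<Sum>i<n. y i) = (\<Sum>i<n. z i) / s" by (simp add: y_def sum_divide_distrib)
    moreover have "(\<Sum>i<n. (y i)\<^sup>2) = (\<Sum>i<n. (z i)\<^sup>2) / s\<^sup>2"
      by (simp add: y_def sum_divide_distrib power_divide)
    moreover have "y i \<in> {-1..1}" for i
    proof (cases "i < n")
      case True
      hence "(z i)\<^sup>2 \<le> s\<^sup>2" unfolding s by (intro member_le_sum) auto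
      hence "\<bar>z i\<bar> \<le> s" using s(1) by (metis abs_le_square_iff abs_of_pos)
      thus ?thesis using True s(1) by (auto simp: y_def field_simps abs_le_iff)
    qed (simp add: y_def)
    ultimately have "y \<in> K" using s z0 by (auto simp: K_def B_def)
    moreover have "s\<^sup>2 * q y = q z"
    proof -
      have "s\<^sup>2 * q y = (\<Sum>i<n. \<Sum>j<n. s\<^sup>2 * (y i * M i j * y j))"
        by (simp add: q_def sum_distrib_left)
      also have "\<dots> = q z" unfolding q_def
        using s(1) by (intro sum.cong refl) (simp add: y_def power2_eq_square)
      finally show ?thesis .
    qed
    ultimately show ?thesis using s by auto
  qed
  have "continuous_on UNIV q" unfolding q_def by (intro continuous_intros coord)
  hence "continuous_on K q" by (rule continuous_on_subset) simp
  moreover have "K \<noteq> {}" using scaled[OF x0 x1] by auto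
  ultimately obtain y where y: "y \<in> K" "\<forall>z\<in>K. q y \<le> q z"
    using continuous_attains_inf[OF K] by blast
  have "q y * (\<Sum>i<n. (z i)\<^sup>2) \<le> q z" if z0: "(\<Sum>i<n. z i) = 0" for z
  proof (cases "(\<Sum>i<n. (z i)\<^sup>2) > 0")
    case True
    then obtain z' where z': "z' \<in> K" "(\<Sum>i<n. (z i)\<^sup>2) * q z' = q z" using scaled[OF z0] by auto
    have "(\<Sum>i<n. (z i)\<^sup>2) * q y \<le> (\<Sum>i<n. (z i)\<^sup>2) * q z'"
      using y z' True by (intro mult_left_mono) auto
    thus ?thesis using z' by (simp add: mult.commute)
  next
    case False
    hence "(\<Sum>i<n. (z i)\<^sup>2) = 0" by (smt (verit) sum_nonneg zero_le_power2)
    moreover from this have "z i = 0" if "i < n" for i using that by (simp add: sum_nonneg_eq_0_iff)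
    ultimately show ?thesis by (simp add: q_def)
  qed
  thus ?thesis using y unfolding K_def q_def by blast
qed

lemma linear_term_zero_if_quadratic_nonneg:
  fixes a b :: real
  assumes nonneg: "\<And>t. 0 \<le> 2 * t * a + t\<^sup>2 * b"
  shows "a = 0"
proof (rule ccontr)
  assume a: "a \<noteq> 0"
  \<comment> \<open>At \<open>t = - a / B\<close> the linear term outweighs the quadratic one.\<close>
  define B where "B = \<bar>b\<bar> + 1"
  have B: "B > 0" "b < B" by (auto simp: B_def)
  have "0 \<le> 2 * (- a / B) * a + (- a / B)\<^sup>2 * b" by (rule nonneg)
  also have "\<dots> = (a / B)\<^sup>2 * (b - 2 * B)" using B by (simp add: field_simps power2_eq_square)
  also have "\<dots> < 0" using a B by (intro mult_pos_neg) auto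
  finally show False by simp
qed

lemma quadratic_form_as_sum:
  assumes "C \<in> carrier_mat n n" "v \<in> carrier_vec n"
  shows "v \<bullet> (C *\<^sub>v v) = (\<Sum>i<n. \<Sum>j<n. v $ i * C $$ (i, j) * (v $ j :: real))"
  using assms by (simp add: scalar_prod_def atLeast0LessThan sum_distrib_left mult.assoc)

lemma contrast_as_sum:
  "v \<in> carrier_vec n \<Longrightarrow> v \<bullet> vec n (\<lambda>_. 1) = (\<Sum>i<n. v $ i :: real)"
  by (simp add: scalar_prod_def atLeast0LessThan)

lemma square_norm_as_sum:
  "v \<in> carrier_vec n \<Longrightarrow> v \<bullet> v = (\<Sum>i<n. (v $ i :: real)\<^sup>2)"
  by (simp add: scalar_prod_def atLeast0LessThan power2_eq_square)

text \<open>
  At a minimizer \<open>v\<close> with minimum \<open>e\<close>, moving in the direction \<open>d = C v - e v\<close>, which is again a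
  contrast, cannot decrease the form \<open>z' C z - e z' z\<close> below \<open>0\<close>. Its linear term along this line is
  \<open>2 t d' d\<close>, so \<open>d = 0\<close> and \<open>v\<close> is an eigenvector.
\<close>

lemma minimal_contrast_eigenpair:
  fixes C :: "real mat" and x :: "real vec"
  assumes C: "C \<in> carrier_mat n n"
    and adj: "\<And>x y. x \<in> carrier_vec n \<Longrightarrow> y \<in> carrier_vec n \<Longrightarrow> x \<bullet> (C *\<^sub>v y) = (C *\<^sub>v x) \<bullet> y"
    and ker: "C *\<^sub>v vec n (\<lambda>_. 1) = 0\<^sub>v n"
    and x: "x \<in> carrier_vec n" "x \<noteq> 0\<^sub>v n" "x \<bullet> vec n (\<lambda>_. 1) = 0"
  obtains e v where "eigenvector C v e" "v \<bullet> vec n (\<lambda>_. 1) = 0"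
    and "\<And>z. z \<in> carrier_vec n \<Longrightarrow> z \<bullet> vec n (\<lambda>_. 1) = 0 \<Longrightarrow> e * (z \<bullet> z) \<le> z \<bullet> (C *\<^sub>v z)"
proof -
  let ?one = "vec n (\<lambda>_. 1 :: real)"
  have "(\<Sum>i<n. (x $ i)\<^sup>2) > 0"
    using x scalar_prod_self_eq_0[of x n] scalar_prod_self_nonneg[of x]
    by (auto simp: square_norm_as_sum[of x n] less_le)
  then obtain y where y0: "(\<Sum>i<n. y i) = 0" and y1: "(\<Sum>i<n. (y i)\<^sup>2) = 1"
    and ymin: "\<And>z. (\<Sum>i<n. z i) = 0 \<Longrightarrow>
      (\<Sum>i<n. \<Sum>j<n. y i * C $$ (i, j) * y j) * (\<Sum>i<n. (z i)\<^sup>2) \<le> (\<Sum>i<n. \<Sum>j<n. z i * C $$ (i, j) * z j)"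
    using rayleigh_minimizer_exists[of "\<lambda>i. x $ i" n "\<lambda>i j. C $$ (i, j)"] x
    by (auto simp: contrast_as_sum[of x n])
  define v where "v = vec n y"
  define e where "e = v \<bullet> (C *\<^sub>v v)"
  have v: "v \<in> carrier_vec n" by (simp add: v_def)
  have v0: "v \<bullet> ?one = 0" using y0 by (simp add: contrast_as_sum[OF v]) (simp add: v_def)
  have v1: "v \<bullet> v = 1" using y1 by (simp add: square_norm_as_sum[OF v]) (simp add: v_def)
  have "e = (\<Sum>i<n. \<Sum>j<n. y i * C $$ (i, j) * y j)"
    by (simp add: e_def quadratic_form_as_sum[OF C v]) (simp add: v_def)
  hence min: "e * (z \<bullet> z) \<le> z \<bullet> (C *\<^sub>v z)" if "z \<in> carrier_vec n" "z \<bullet> ?one = 0" for z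
    using ymin[of "\<lambda>i. z $ i"] that
    by (simp add: contrast_as_sum[of z n] square_norm_as_sum[of z n] quadratic_form_as_sum[OF C])
  have Cc: "C *\<^sub>v z \<in> carrier_vec n" for z using C by (intro carrier_vecI) simp
  define d where "d = C *\<^sub>v v - e \<cdot>\<^sub>v v"
  have d: "d \<in> carrier_vec n" using v Cc by (simp add: d_def)
  have d0: "d \<bullet> ?one = 0"
  proof -
    have "(C *\<^sub>v v) \<bullet> ?one = v \<bullet> (C *\<^sub>v ?one)" using adj[OF v, of ?one] by simp
    also have "\<dots> = 0" using ker v by simp
    finally show ?thesis using v Cc v0 by (simp add: d_def minus_scalar_prod_distrib[of _ n])
  qed
  have dd: "d \<bullet> d = d \<bullet> (C *\<^sub>v v) - e * (d \<bullet> v)"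
    using d v Cc by (subst (2) d_def) (simp add: scalar_prod_minus_distrib[of _ n])
  have "0 \<le> 2 * t * (d \<bullet> d) + t\<^sup>2 * (d \<bullet> (C *\<^sub>v d) - e * (d \<bullet> d))" for t
  proof -
    let ?z = "v + t \<cdot>\<^sub>v d"
    have z: "?z \<in> carrier_vec n" using v d by simp
    have "?z \<bullet> ?one = 0" using v d v0 d0 by (simp add: add_scalar_prod_distrib[of _ n])
    hence "e * (?z \<bullet> ?z) \<le> ?z \<bullet> (C *\<^sub>v ?z)" using z min by blast
    moreover have "?z \<bullet> ?z = 1 + 2 * t * (d \<bullet> v) + t\<^sup>2 * (d \<bullet> d)"
      using v d v1 by (simp add: add_scalar_prod_distrib[of _ n] scalar_prod_add_distrib[of _ n]
          comm_scalar_prod[of v n d] power2_eq_square algebra_simps)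
    moreover have "?z \<bullet> (C *\<^sub>v ?z) = e + 2 * t * (d \<bullet> (C *\<^sub>v v)) + t\<^sup>2 * (d \<bullet> (C *\<^sub>v d))"
    proof -
      have "C *\<^sub>v ?z = C *\<^sub>v v + t \<cdot>\<^sub>v (C *\<^sub>v d)"
        using C v d by (simp add: mult_add_distrib_mat_vec[of _ n n] mult_mat_vec[of _ n n])
      moreover have "v \<bullet> (C *\<^sub>v d) = d \<bullet> (C *\<^sub>v v)"
        using adj[OF v d] d Cc by (simp add: comm_scalar_prod[of _ n])
      ultimately show ?thesis
        using v d Cc by (simp add: add_scalar_prod_distrib[of _ n] scalar_prod_add_distrib[of _ n]
            e_def power2_eq_square algebra_simps)
    qed
    ultimately have "0 \<le> (e + 2 * t * (d \<bullet> (C *\<^sub>v v)) + t\<^sup>2 * (d \<bullet> (C *\<^sub>v d)))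
        - e * (1 + 2 * t * (d \<bullet> v) + t\<^sup>2 * (d \<bullet> d))" by simp
    also have "\<dots> = 2 * t * (d \<bullet> (C *\<^sub>v v) - e * (d \<bullet> v)) + t\<^sup>2 * (d \<bullet> (C *\<^sub>v d) - e * (d \<bullet> d))"
      by (simp add: algebra_simps)
    finally show ?thesis unfolding dd[symmetric] .
  qed
  hence "d \<bullet> d = 0" by (rule linear_term_zero_if_quadratic_nonneg)
  hence "d = 0\<^sub>v n" using d by (rule scalar_prod_self_eq_0)
  hence "d $ i = 0" if "i < n" for i using that by simp
  hence "C *\<^sub>v v = e \<cdot>\<^sub>v v" using C v by (intro eq_vecI) (auto simp: d_def)
  moreover have "v \<noteq> 0\<^sub>v n" using v1 v by auto
  ultimately have "eigenvector C v e" using C v by (simp add: eigenvector_def)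
  thus ?thesis using that v0 min by blast
qed

text \<open>
  The minimum that defines the smallest contrast eigenvalue is taken over a subset of the spectrum,
  which is finite, and this subset contains the minimal Rayleigh quotient. Hence the minimum is attained
  and bounds all Rayleigh quotients of contrasts; \<open>x\<close> excludes the case that \<open>0\<close> is the only contrast.
\<close>

lemma smallest_contrast_eigenvalue_rayleigh:
  fixes C :: "real mat" and x :: "real vec"
  assumes C: "C \<in> carrier_mat n n"
    and adj: "\<And>x y. x \<in> carrier_vec n \<Longrightarrow> y \<in> carrier_vec n \<Longrightarrow> x \<bullet> (C *\<^sub>v y) = (C *\<^sub>v x) \<bullet> y"
    and ker: "C *\<^sub>v vec n (\<lambda>_. 1) = 0\<^sub>v n"
    and x: "x \<in> carrier_vec n" "x \<noteq> 0\<^sub>v n" "x \<bullet> vec n (\<lambda>_. 1) = 0"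
  shows "smallest_contrast_eigenvalue C * (x \<bullet> x) \<le> x \<bullet> (C *\<^sub>v x)"
    and "\<exists>v. v \<in> carrier_vec n \<and> v \<noteq> 0\<^sub>v n \<and> v \<bullet> vec n (\<lambda>_. 1) = 0 \<and>
          v \<bullet> (C *\<^sub>v v) = smallest_contrast_eigenvalue C * (v \<bullet> v)"
proof -
  let ?one = "vec n (\<lambda>_. 1 :: real)"
  let ?E = "{e. \<exists>v. eigenvector C v e \<and> v \<bullet> vec (dim_row C) (\<lambda>_. 1) = 0}"
  have n: "dim_row C = n" using C by simp
  have "?E \<subseteq> spectrum C" by (auto simp: spectrum_def eigenvalue_def)
  hence fin: "finite ?E" using card_finite_spectrum(1)[OF C] by (rule finite_subset)
  obtain e v where ev: "eigenvector C v e" "v \<bullet> ?one = 0"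
    and min: "\<And>z. z \<in> carrier_vec n \<Longrightarrow> z \<bullet> ?one = 0 \<Longrightarrow> e * (z \<bullet> z) \<le> z \<bullet> (C *\<^sub>v z)"
    using minimal_contrast_eigenpair[OF C adj ker x] by blast
  have eE: "e \<in> ?E" using ev n by auto
  hence "smallest_contrast_eigenvalue C \<le> e"
    unfolding smallest_contrast_eigenvalue_def using fin by (rule Min_le[rotated])
  hence "smallest_contrast_eigenvalue C * (x \<bullet> x) \<le> e * (x \<bullet> x)"
    by (rule mult_right_mono) (rule scalar_prod_self_nonneg)
  also have "\<dots> \<le> x \<bullet> (C *\<^sub>v x)" using x by (intro min) auto
  finally show "smallest_contrast_eigenvalue C * (x \<bullet> x) \<le> x \<bullet> (C *\<^sub>v x)" .
  have "smallest_contrast_eigenvalue C \<in> ?E"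
    unfolding smallest_contrast_eigenvalue_def using fin eE by (intro Min_in) auto
  then obtain v where "eigenvector C v (smallest_contrast_eigenvalue C)" "v \<bullet> ?one = 0"
    unfolding n by blast
  thus "\<exists>v. v \<in> carrier_vec n \<and> v \<noteq> 0\<^sub>v n \<and> v \<bullet> ?one = 0 \<and>
          v \<bullet> (C *\<^sub>v v) = smallest_contrast_eigenvalue C * (v \<bullet> v)"
    unfolding eigenvector_def n by (intro exI[of _ v]) auto
qed

section \<open>The quadratic form of an information matrix\<close>

lemma mult_mat_vec_in_vec_span:
  fixes X :: "real mat"
  assumes X: "X \<in> carrier_mat N p" and XS: "set (cols X) \<subseteq> S" and S: "S \<subseteq> carrier_vec N"
    and u: "u \<in> carrier_vec p"
  shows "X *\<^sub>v u \<in> vec_span N S"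
proof -
  interpret vec_space "TYPE(real)" N .
  have cols: "set (cols X) \<subseteq> carrier_vec N" using XS S by blast
  have "X *\<^sub>v u = mat_of_cols N (cols X) *\<^sub>v vec (length (cols X)) (\<lambda>j. u $ j)"
  proof -
    have "vec (length (cols X)) (\<lambda>j. u $ j) = u" using X u by (intro eq_vecI) auto
    moreover have "mat_of_cols N (cols X) = X" using X mat_of_cols_cols[of X] by auto
    ultimately show ?thesis by simp
  qed
  also have "\<dots> = lincomb_list (\<lambda>j. u $ j) (cols X)"
    using cols by (intro lincomb_list_as_mat_mult[symmetric]) auto
  also have "\<dots> \<in> span_list (cols X)" by (auto simp: span_list_def)
  also have "span_list (cols X) = span (set (cols X))" using cols by (rule span_list_as_span)
  also have "\<dots> \<subseteq> vec_span N S" unfolding vec_span_def[symmetric] by (rule vec_span_mono[OF XS])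
  finally show ?thesis .
qed

lemma design_mat_carrier [simp]: "design_mat R i p \<in> carrier_mat (dim_col R) p"
  by (simp add: design_mat_def)

lemma design_mat_mult_vec_index:
  assumes "c < dim_col R" "R $$ (i, c) < p" "u \<in> carrier_vec p"
  shows "(design_mat R i p *\<^sub>v u) $ c = u $ (R $$ (i, c))"
proof -
  have "(design_mat R i p *\<^sub>v u) $ c = (\<Sum>x<p. (if R $$ (i, c) = x then 1 else 0) * u $ x)"
    using assms by (simp add: design_mat_def scalar_prod_def atLeast0LessThan)
  also have "\<dots> = (\<Sum>x<p. if R $$ (i, c) = x then u $ x else 0)" by (intro sum.cong) auto
  also have "\<dots> = u $ (R $$ (i, c))" using assms by simp
  finally show ?thesis .
qed

lemma scalar_prod_design_col:
  assumes "x < p" "z \<in> carrier_vec (dim_col R)"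
  shows "z \<bullet> col (design_mat R j p) x = (\<Sum>c | c < dim_col R \<and> R $$ (j, c) = x. z $ c)"
proof -
  have "z \<bullet> col (design_mat R j p) x = (\<Sum>c<dim_col R. if R $$ (j, c) = x then z $ c else 0)"
    using assms by (auto simp: scalar_prod_def design_mat_def atLeast0LessThan intro!: sum.cong)
  also have "\<dots> = (\<Sum>c | c < dim_col R \<and> R $$ (j, c) = x. z $ c)"
    by (simp add: sum.If_cases Int_def)
  finally show ?thesis .
qed

definition nuisance_generators :: "nat \<Rightarrow> (nat \<Rightarrow> nat) \<Rightarrow> nat \<Rightarrow> nat mat \<Rightarrow> nat \<Rightarrow> real vec set" where
  "nuisance_generators m s b R i =
     set (cols (design_mat R 0 b)) \<union> (\<Union>j \<in> {1..m} - {i}. set (cols (design_mat R j (s j))))"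

lemma set_cols_design_mat: "set (cols (design_mat R j p)) = col (design_mat R j p) ` {..<p}"
  by (auto simp: cols_def design_mat_def)

lemma nuisance_generators_carrier: "nuisance_generators m s b R i \<subseteq> carrier_vec (dim_col R)"
proof -
  have "set (cols (design_mat R j p)) \<subseteq> carrier_vec (dim_col R)" for j p
    using cols_dim[of "design_mat R j p"] design_mat_carrier[of R j p] by (simp only: carrier_matD)
  thus ?thesis unfolding nuisance_generators_def by blast
qed

lemma finite_nuisance_generators: "finite (nuisance_generators m s b R i)"
  by (simp add: nuisance_generators_def)

lemma nuisance_space_eq:
  "nuisance_space m s b R i = vec_span (dim_col R) (nuisance_generators m s b R i)"
  by (simp add: nuisance_space_def nuisance_generators_def)

lemma nuisance_proj:
  "is_orth_proj (dim_col R) (nuisance_space m s b R i) (orth_proj (dim_col R) (nuisance_space m s b R i))"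
  unfolding nuisance_space_eq
  by (rule orth_proj_is_orth_proj[OF finite_nuisance_generators nuisance_generators_carrier])

lemma information_mat_carrier: "information_mat m s b R i \<in> carrier_mat (s i) (s i)"
  by (intro carrier_matI) (simp_all add: information_mat_def design_mat_def)

lemma information_mat_mult_vec:
  assumes "v \<in> carrier_vec (s i)"
  shows "information_mat m s b R i *\<^sub>v v =
    transpose_mat (design_mat R i (s i)) *\<^sub>v (design_mat R i (s i) *\<^sub>v v -
      orth_proj (dim_col R) (nuisance_space m s b R i) *\<^sub>v (design_mat R i (s i) *\<^sub>v v))"
proof -
  let ?N = "dim_col R" and ?X = "design_mat R i (s i)"
  let ?P = "orth_proj ?N (nuisance_space m s b R i)"
  have P: "?P \<in> carrier_mat ?N ?N" using nuisance_proj by (auto simp: is_orth_proj_def)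
  have X: "?X \<in> carrier_mat ?N (s i)" and Xt: "transpose_mat ?X \<in> carrier_mat (s i) ?N" by simp_all
  have Xv: "?X *\<^sub>v v \<in> carrier_vec ?N" by (intro carrier_vecI) (simp add: design_mat_def)
  have "information_mat m s b R i *\<^sub>v v = transpose_mat ?X *\<^sub>v ((1\<^sub>m ?N - ?P) *\<^sub>v (?X *\<^sub>v v))"
  proof -
    have Q: "1\<^sub>m ?N - ?P \<in> carrier_mat ?N ?N" using P by (rule minus_carrier_mat)
    have "information_mat m s b R i *\<^sub>v v = transpose_mat ?X * (1\<^sub>m ?N - ?P) *\<^sub>v (?X *\<^sub>v v)"
      unfolding information_mat_def by (rule assoc_mult_mat_vec[OF mult_carrier_mat[OF Xt Q] X assms])
    also have "\<dots> = transpose_mat ?X *\<^sub>v ((1\<^sub>m ?N - ?P) *\<^sub>v (?X *\<^sub>v v))"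
      by (rule assoc_mult_mat_vec[OF Xt Q Xv])
    finally show ?thesis .
  qed
  also have "(1\<^sub>m ?N - ?P) *\<^sub>v (?X *\<^sub>v v) = ?X *\<^sub>v v - ?P *\<^sub>v (?X *\<^sub>v v)"
    using P Xv by (subst minus_mult_distrib_mat_vec[of _ ?N ?N]) auto
  finally show ?thesis .
qed

lemma information_bilinear_form:
  assumes x: "x \<in> carrier_vec (s i)" and v: "v \<in> carrier_vec (s i)"
  shows "x \<bullet> (information_mat m s b R i *\<^sub>v v) =
    (design_mat R i (s i) *\<^sub>v x) \<bullet> (design_mat R i (s i) *\<^sub>v v -
      orth_proj (dim_col R) (nuisance_space m s b R i) *\<^sub>v (design_mat R i (s i) *\<^sub>v v))"
proof -
  let ?N = "dim_col R" and ?X = "design_mat R i (s i)"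
  let ?P = "orth_proj ?N (nuisance_space m s b R i)"
  have P: "?P \<in> carrier_mat ?N ?N" using nuisance_proj by (auto simp: is_orth_proj_def)
  have X: "?X \<in> carrier_mat ?N (s i)" by simp
  have r: "?X *\<^sub>v v - ?P *\<^sub>v (?X *\<^sub>v v) \<in> carrier_vec ?N" (is "?r \<in> _")
    using P by (intro carrier_vecI) auto
  have "x \<bullet> (transpose_mat ?X *\<^sub>v ?r) = (transpose_mat ?X *\<^sub>v ?r) \<bullet> x"
    using x by (intro comm_scalar_prod[of _ "s i"] carrier_vecI) (auto simp: design_mat_def)
  also have "\<dots> = ?r \<bullet> (?X *\<^sub>v x)" using X x r by (rule transpose_vec_mult_scalar)
  also have "\<dots> = (?X *\<^sub>v x) \<bullet> ?r"
    using r by (intro comm_scalar_prod[of _ ?N]) (auto intro: carrier_vecI simp: design_mat_def)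
  finally show ?thesis unfolding information_mat_mult_vec[where s = s and i = i, OF v] .
qed

lemma information_mat_self_adjoint:
  assumes x: "x \<in> carrier_vec (s i)" and v: "v \<in> carrier_vec (s i)"
  shows "x \<bullet> (information_mat m s b R i *\<^sub>v v) = (information_mat m s b R i *\<^sub>v x) \<bullet> v"
proof -
  let ?N = "dim_col R" and ?X = "design_mat R i (s i)" and ?C = "information_mat m s b R i"
  let ?P = "orth_proj ?N (nuisance_space m s b R i)"
  have P: "?P \<in> carrier_mat ?N ?N" using nuisance_proj by (auto simp: is_orth_proj_def)
  have Xc: "?X *\<^sub>v w \<in> carrier_vec ?N" for w by (intro carrier_vecI) (simp add: design_mat_def)
  have Pc: "?P *\<^sub>v w \<in> carrier_vec ?N" for w using P by (intro carrier_vecI) auto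
  note adj = is_orth_proj_self_adjoint[OF nuisance_generators_carrier
      nuisance_proj[of R m s b i, unfolded nuisance_space_eq], folded nuisance_space_eq, OF Xc Xc]
  have form: "y \<bullet> (?C *\<^sub>v w) = (?X *\<^sub>v y) \<bullet> (?X *\<^sub>v w) - (?P *\<^sub>v (?X *\<^sub>v y)) \<bullet> (?P *\<^sub>v (?X *\<^sub>v w))"
    if "y \<in> carrier_vec (s i)" "w \<in> carrier_vec (s i)" for y w
    unfolding information_bilinear_form[where s = s and i = i, OF that]
    using adj by (simp add: scalar_prod_minus_distrib[OF Xc Xc Pc])
  have "x \<bullet> (?C *\<^sub>v v) = v \<bullet> (?C *\<^sub>v x)"
    unfolding form[OF x v] form[OF v x]
    by (simp add: comm_scalar_prod[OF Xc Xc, of x v] comm_scalar_prod[OF Pc Pc, of "?X *\<^sub>v x"])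
  also have "\<dots> = (?C *\<^sub>v x) \<bullet> v"
    using v information_mat_carrier[of m s b R i] by (intro comm_scalar_prod[of _ "s i"] carrier_vecI) auto
  finally show ?thesis .
qed

text \<open>
  The form is the squared distance of \<open>y = X\<^sub>i v\<close> from the nuisance space, and the second equation is
  the theorem of Pythagoras for the distance to another vector \<open>w\<close> of that space.
\<close>

lemma information_quadratic_form:
  fixes R :: "nat mat" and v w :: "real vec" and s :: "nat \<Rightarrow> nat" and m b i :: nat
  defines "y \<equiv> design_mat R i (s i) *\<^sub>v v"
  defines "p \<equiv> orth_proj (dim_col R) (nuisance_space m s b R i) *\<^sub>v y"
  assumes v: "v \<in> carrier_vec (s i)" and w: "w \<in> nuisance_space m s b R i"
  shows "v \<bullet> (information_mat m s b R i *\<^sub>v v) = (y - p) \<bullet> (y - p)"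
    and "(y - w) \<bullet> (y - w) = v \<bullet> (information_mat m s b R i *\<^sub>v v) + (p - w) \<bullet> (p - w)"
proof -
  let ?N = "dim_col R"
  let ?W = "nuisance_space m s b R i"
  let ?P = "orth_proj ?N ?W"
  have P: "?P \<in> carrier_mat ?N ?N" using nuisance_proj by (auto simp: is_orth_proj_def)
  have y: "y \<in> carrier_vec ?N" unfolding y_def using v by (intro carrier_vecI) (simp add: design_mat_def)
  have p: "p \<in> carrier_vec ?N" unfolding p_def using P y by auto
  have wc: "w \<in> carrier_vec ?N"
    using w vec_span_carrier[OF nuisance_generators_carrier] unfolding nuisance_space_eq by blast
  have pW: "p \<in> ?W" and orth: "u \<bullet> (y - p) = 0" if "u \<in> ?W" for u
    using nuisance_proj[of R m s b i] y that by (auto simp: is_orth_proj_def p_def)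
  have pW: "p \<in> ?W" using pW[OF w] .
  have "(y - p) \<bullet> (y - p) = y \<bullet> (y - p) - p \<bullet> (y - p)"
    using y p by (intro minus_scalar_prod_distrib) auto
  thus form: "v \<bullet> (information_mat m s b R i *\<^sub>v v) = (y - p) \<bullet> (y - p)"
    using orth[OF pW] by (simp add: information_bilinear_form[where s = s and i = i, OF v v] y_def p_def)
  have "p - w \<in> ?W"
    using pW w vec_span_diff[OF nuisance_generators_carrier] unfolding nuisance_space_eq by blast
  hence "(p - w) \<bullet> (y - p) = 0" by (rule orth)
  moreover from this have "(y - p) \<bullet> (p - w) = 0"
    using y p wc by (subst comm_scalar_prod[of _ ?N]) auto
  moreover have "y - w = (y - p) + (p - w)" using y p wc by (intro eq_vecI) auto
  ultimately show "(y - w) \<bullet> (y - w) = v \<bullet> (information_mat m s b R i *\<^sub>v v) + (p - w) \<bullet> (p - w)"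
    unfolding form using y p wc
    by (simp add: add_scalar_prod_distrib[of _ ?N] scalar_prod_add_distrib[of _ ?N])
qed

lemma information_quadratic_form_le:
  assumes "v \<in> carrier_vec (s i)" and "w \<in> nuisance_space m s b R i"
  shows "v \<bullet> (information_mat m s b R i *\<^sub>v v) \<le>
    (design_mat R i (s i) *\<^sub>v v - w) \<bullet> (design_mat R i (s i) *\<^sub>v v - w)"
  using information_quadratic_form(2)[OF assms] scalar_prod_self_nonneg by simp

lemma information_quadratic_form_eq:
  assumes v: "v \<in> carrier_vec (s i)" and w: "w \<in> nuisance_space m s b R i"
    and orth: "\<And>u. u \<in> nuisance_generators m s b R i \<Longrightarrow> (design_mat R i (s i) *\<^sub>v v - w) \<bullet> u = 0"
  shows "v \<bullet> (information_mat m s b R i *\<^sub>v v) =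
    (design_mat R i (s i) *\<^sub>v v - w) \<bullet> (design_mat R i (s i) *\<^sub>v v - w)"
proof -
  let ?N = "dim_col R" and ?y = "design_mat R i (s i) *\<^sub>v v"
  let ?P = "orth_proj ?N (nuisance_space m s b R i)"
  note G = nuisance_generators_carrier[of m s b R i]
  have wc: "w \<in> carrier_vec ?N" using w vec_span_carrier[OF G] unfolding nuisance_space_eq by blast
  have y: "?y \<in> carrier_vec ?N" by (intro carrier_vecI) (simp add: design_mat_def)
  have "u \<bullet> (?y - w) = 0" if "u \<in> nuisance_space m s b R i" for u
    using orthogonal_to_vec_span[OF G, of "?y - w" u] that orth wc y by (simp add: nuisance_space_eq)
  hence "?P *\<^sub>v ?y = w"
    using w y nuisance_proj[of R m s b i] unfolding is_orth_proj_def nuisance_space_eq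
    by (intro orthogonal_decomposition_unique[OF G, of ?y]) auto
  thus ?thesis using information_quadratic_form(1)[OF v w] by simp
qed

lemma block_vector_in_nuisance_space:
  "u \<in> carrier_vec b \<Longrightarrow> design_mat R 0 b *\<^sub>v u \<in> nuisance_space m s b R i"
  unfolding nuisance_space_eq
  by (rule mult_mat_vec_in_vec_span[OF design_mat_carrier _ nuisance_generators_carrier])
    (auto simp: nuisance_generators_def)

lemma blocked_mepD:
  assumes "blocked_mep m s b k R"
  shows "dim_col R = b * k" "\<And>c. c < b * k \<Longrightarrow> R $$ (0, c) < b"
    "\<And>i c. i \<in> {1..m} \<Longrightarrow> c < b * k \<Longrightarrow> R $$ (i, c) < s i"
    "\<And>j. j < b \<Longrightarrow> card {c. c < b * k \<and> R $$ (0, c) = j} = k" "0 < b" "0 < k"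
  using assms by (auto simp: blocked_mep_def)

lemma residual_index:
  assumes R: "blocked_mep m s b k R" and i: "i \<in> {1..m}" and c: "c < b * k"
  shows "(design_mat R i (s i) *\<^sub>v vec (s i) x - design_mat R 0 b *\<^sub>v vec b a) $ c
    = x (R $$ (i, c)) - a (R $$ (0, c))"
proof -
  note D = blocked_mepD[OF R]
  have "c < dim_vec (design_mat R 0 b *\<^sub>v vec b a)" using D(1) c by (simp add: design_mat_def)
  thus ?thesis using D(1) D(2)[OF c] D(3)[OF i c] c
    by (simp add: design_mat_mult_vec_index del: index_mult_mat_vec)
qed

lemma residual_square_norm:
  fixes x a :: "nat \<Rightarrow> real" and R :: "nat mat" and s :: "nat \<Rightarrow> nat" and m b k i :: nat
  assumes R: "blocked_mep m s b k R" and i: "i \<in> {1..m}"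
  defines "r \<equiv> design_mat R i (s i) *\<^sub>v vec (s i) x - design_mat R 0 b *\<^sub>v vec b a"
  shows "r \<bullet> r = (\<Sum>c<b * k. (x (R $$ (i, c)) - a (R $$ (0, c)))\<^sup>2)"
proof -
  have "r \<in> carrier_vec (b * k)"
    using blocked_mepD(1)[OF R] by (intro carrier_vecI) (simp add: r_def design_mat_def)
  hence "r \<bullet> r = (\<Sum>c<b * k. (r $ c)\<^sup>2)" by (rule square_norm_as_sum)
  also have "\<dots> = (\<Sum>c<b * k. (x (R $$ (i, c)) - a (R $$ (0, c)))\<^sup>2)"
    unfolding r_def using residual_index[OF R i] by (intro sum.cong refl) simp
  finally show ?thesis .
qed

lemma information_form_le_block_residuals:
  assumes R: "blocked_mep m s b k R" and i: "i \<in> {1..m}"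
  shows "vec (s i) x \<bullet> (information_mat m s b R i *\<^sub>v vec (s i) x)
    \<le> (\<Sum>c<b * k. (x (R $$ (i, c)) - a (R $$ (0, c)))\<^sup>2)"
  unfolding residual_square_norm[OF R i, symmetric]
  by (intro information_quadratic_form_le block_vector_in_nuisance_space) auto

text \<open>
  The all-one vector of runs is the sum of the block indicators, hence in the nuisance space, and it
  is also \<open>X\<^sub>i\<close> applied to the all-one vector of levels.
\<close>

lemma information_mat_mult_ones:
  assumes R: "blocked_mep m s b k R" and i: "i \<in> {1..m}"
  shows "information_mat m s b R i *\<^sub>v vec (s i) (\<lambda>_. 1) = 0\<^sub>v (s i)"
proof -
  let ?N = "dim_col R" and ?X = "design_mat R i (s i)" and ?one = "vec (s i) (\<lambda>_. 1 :: real)"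
  let ?P = "orth_proj ?N (nuisance_space m s b R i)"
  let ?r = "?X *\<^sub>v ?one - ?P *\<^sub>v (?X *\<^sub>v ?one)"
  have P: "?P \<in> carrier_mat ?N ?N" using nuisance_proj by (auto simp: is_orth_proj_def)
  have r: "?r \<in> carrier_vec ?N" using P by (intro carrier_vecI) auto
  have "?one \<bullet> (information_mat m s b R i *\<^sub>v ?one) \<le> 0"
    using information_form_le_block_residuals[OF R i, of "\<lambda>_. 1" "\<lambda>_. 1"] by simp
  hence "?r \<bullet> ?r \<le> 0"
    using information_quadratic_form(1)[of ?one s i "design_mat R 0 b *\<^sub>v vec b (\<lambda>_. 0)" m b R]
    by (simp add: block_vector_in_nuisance_space)
  hence "?r \<bullet> ?r = 0" using scalar_prod_self_nonneg[of ?r] by simp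
  hence "?r = 0\<^sub>v ?N" using r by (rule scalar_prod_self_eq_0)
  moreover have "transpose_mat ?X *\<^sub>v 0\<^sub>v ?N = 0\<^sub>v (s i)"
    by (intro eq_vecI) (auto simp: design_mat_def)
  ultimately show ?thesis by (simp add: information_mat_mult_vec)
qed

lemma sum_by_value:
  fixes f :: "nat \<Rightarrow> real"
  assumes "finite A" "\<And>c. c \<in> A \<Longrightarrow> g c < q"
  shows "(\<Sum>c\<in>A. f (g c)) = (\<Sum>x<q. real (card {c\<in>A. g c = x}) * f x)"
proof -
  have "(\<Sum>c\<in>A. f (g c)) = (\<Sum>x<q. \<Sum>c | c \<in> A \<and> g c = x. f (g c))"
    using assms by (intro sum.group[symmetric]) auto
  also have "\<dots> = (\<Sum>x<q. real (card {c\<in>A. g c = x}) * f x)"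
    by (intro sum.cong refl) simp
  finally show ?thesis .
qed

text \<open>
  Residuals from block averages sum to zero over each block. Their sum over the runs with
  level \<open>q\<close> of another factor \<open>j\<close> is, by linearity, a combination of the entries of
  \<open>M\<^sub>i\<^sub>j - M\<^sub>i\<^sub>B M\<^sub>j\<^sub>B' / k\<close>, and orthogonality through the blocks makes these vanish. So the block averages
  are the orthogonal projection onto the whole nuisance space.
\<close>

lemma potb_information_form:
  fixes x :: "nat \<Rightarrow> real" and R :: "nat mat" and s :: "nat \<Rightarrow> nat" and m b k i :: nat
  assumes potb: "potb m s b k R" and i: "i \<in> {1..m}"
  defines "avg \<equiv> \<lambda>j. (\<Sum>c | c < b * k \<and> R $$ (0, c) = j. x (R $$ (i, c))) / real k"
  shows "vec (s i) x \<bullet> (information_mat m s b R i *\<^sub>v vec (s i) x)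
    = (\<Sum>c<b * k. (x (R $$ (i, c)) - avg (R $$ (0, c)))\<^sup>2)"
proof -
  have R: "blocked_mep m s b k R" using potb by (simp add: potb_def)
  note D = blocked_mepD[OF R]
  define N where "N i p j = card {c. c < b * k \<and> R $$ (i, c) = p \<and> R $$ (0, c) = j}" for i p j
  let ?r = "design_mat R i (s i) *\<^sub>v vec (s i) x - design_mat R 0 b *\<^sub>v vec b avg"
  have r: "?r \<in> carrier_vec (dim_col R)" by (intro carrier_vecI) (simp add: design_mat_def)
  have rsum: "?r \<bullet> col (design_mat R j p) q
      = (\<Sum>c | c < b * k \<and> R $$ (j, c) = q. x (R $$ (i, c)) - avg (R $$ (0, c)))"
    if "q < p" for j p q
    unfolding scalar_prod_design_col[OF that r] D(1)
    using residual_index[OF R i] by (intro sum.cong refl) simp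
  have avg: "avg j = (\<Sum>p<s i. real (N i p j) * x p) / real k" for j
  proof -
    have "(\<Sum>c | c < b * k \<and> R $$ (0, c) = j. x (R $$ (i, c)))
      = (\<Sum>p<s i. real (card {c \<in> {c. c < b * k \<and> R $$ (0, c) = j}. R $$ (i, c) = p}) * x p)"
      using D(3) i by (intro sum_by_value) auto
    also have "\<dots> = (\<Sum>p<s i. real (N i p j) * x p)"
      unfolding N_def by (intro sum.cong refl arg_cong2[of _ _ _ _ "(*)"] arg_cong[of _ _ "\<lambda>S. real (card S)"]) auto
    finally show ?thesis by (simp add: avg_def)
  qed
  have block_orth: "?r \<bullet> col (design_mat R 0 b) j = 0" if "j < b" for j
  proof -
    have "?r \<bullet> col (design_mat R 0 b) j
      = (\<Sum>c | c < b * k \<and> R $$ (0, c) = j. x (R $$ (i, c)) - avg j)"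
      unfolding rsum[OF that] by (intro sum.cong refl) auto
    also have "\<dots> = (\<Sum>c | c < b * k \<and> R $$ (0, c) = j. x (R $$ (i, c))) - real k * avg j"
      using D(4)[OF that] by (simp add: sum_subtractf)
    also have "\<dots> = 0" using D(6) by (simp add: avg_def)
    finally show ?thesis .
  qed
  have factor_orth: "?r \<bullet> col (design_mat R j (s j)) q = 0"
    if j: "j \<in> {1..m}" "j \<noteq> i" and q: "q < s j" for j q
  proof -
    have otb: "orthogonal_through_block s b k R i j" using potb i j by (auto simp: potb_def)
    have M: "(\<Sum>B<b. N i p B * N j q B) = k * card {c. c < b * k \<and> R $$ (i, c) = p \<and> R $$ (j, c) = q}"
      if "p < s i" for p
    proof -
      have "(block_mat s b R i * transpose_mat (block_mat s b R j)) $$ (p, q)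
        = (k \<cdot>\<^sub>m factor_mat s R i j) $$ (p, q)"
        using otb by (simp only: orthogonal_through_block_def)
      thus ?thesis using that q
        by (simp add: block_mat_def factor_mat_def count_mat_def D(1) scalar_prod_def N_def
            atLeast0LessThan)
    qed
    have "(\<Sum>c | c < b * k \<and> R $$ (j, c) = q. avg (R $$ (0, c)))
      = (\<Sum>B<b. real (card {c \<in> {c. c < b * k \<and> R $$ (j, c) = q}. R $$ (0, c) = B}) * avg B)"
      using D(2) by (intro sum_by_value) auto
    also have "\<dots> = (\<Sum>B<b. real (N j q B) * avg B)"
      unfolding N_def by (intro sum.cong refl arg_cong2[of _ _ _ _ "(*)"] arg_cong[of _ _ "\<lambda>S. real (card S)"]) auto
    also have "\<dots> = (\<Sum>B<b. \<Sum>p<s i. real (N i p B * N j q B) * x p / real k)"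
      by (simp add: avg sum_distrib_left sum_divide_distrib mult_ac)
    also have "\<dots> = (\<Sum>p<s i. real (\<Sum>B<b. N i p B * N j q B) * x p / real k)"
      by (subst sum.swap) (simp add: sum_distrib_right sum_divide_distrib)
    also have "\<dots> = (\<Sum>p<s i. real (card {c. c < b * k \<and> R $$ (i, c) = p \<and> R $$ (j, c) = q}) * x p)"
      using D(6) by (intro sum.cong refl) (simp add: M)
    also have "\<dots> = (\<Sum>p<s i. real (card {c \<in> {c. c < b * k \<and> R $$ (j, c) = q}. R $$ (i, c) = p}) * x p)"
      by (intro sum.cong refl arg_cong2[of _ _ _ _ "(*)"] arg_cong[of _ _ "\<lambda>S. real (card S)"]) auto
    also have "\<dots> = (\<Sum>c | c < b * k \<and> R $$ (j, c) = q. x (R $$ (i, c)))"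
      using D(3) i by (intro sum_by_value[symmetric]) auto
    finally show ?thesis unfolding rsum[OF q] by (simp add: sum_subtractf)
  qed
  have "?r \<bullet> u = 0" if "u \<in> nuisance_generators m s b R i" for u
  proof -
    from that consider j where "j < b" "u = col (design_mat R 0 b) j"
      | j q where "j \<in> {1..m}" "j \<noteq> i" "q < s j" "u = col (design_mat R j (s j)) q"
      unfolding nuisance_generators_def set_cols_design_mat lessThan_def by blast
    thus ?thesis using block_orth factor_orth by cases simp_all
  qed
  hence "vec (s i) x \<bullet> (information_mat m s b R i *\<^sub>v vec (s i) x) = ?r \<bullet> ?r"
    by (intro information_quadratic_form_eq block_vector_in_nuisance_space) auto
  thus ?thesis unfolding residual_square_norm[OF R i] .
qed

section \<open>An upper bound for plans with blocks of size two\<close>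

lemma run_pairs_of_blocks:
  assumes R: "blocked_mep m s b 2 R"
  obtains c d where "\<And>j. j < b \<Longrightarrow> c j < b * 2 \<and> d j < b * 2 \<and> R $$ (0, c j) = j \<and> R $$ (0, d j) = j"
    and "\<And>f :: nat \<Rightarrow> real. (\<Sum>r<b * 2. f r) = (\<Sum>j<b. f (c j) + f (d j))"
proof -
  have "\<forall>j. \<exists>cd. j < b \<longrightarrow> {r. r < b * 2 \<and> R $$ (0, r) = j} = {fst cd, snd cd} \<and> fst cd \<noteq> snd cd"
    using blocked_mepD(4)[OF R] by (auto simp: card_2_iff)
  then obtain cd where cd: "\<And>j. j < b \<Longrightarrow>
      {r. r < b * 2 \<and> R $$ (0, r) = j} = {fst (cd j), snd (cd j)} \<and> fst (cd j) \<noteq> snd (cd j)"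
    by metis
  have block: "(\<Sum>r | r < b * 2 \<and> R $$ (0, r) = j. f r) = f (fst (cd j)) + f (snd (cd j))"
    if "j < b" for j and f :: "nat \<Rightarrow> real"
    using cd[OF that] by simp
  show ?thesis
  proof (rule that[of "\<lambda>j. fst (cd j)" "\<lambda>j. snd (cd j)"])
    fix j assume "j < b"
    from cd[OF this] show "fst (cd j) < b * 2 \<and> snd (cd j) < b * 2 \<and> R $$ (0, fst (cd j)) = j \<and> R $$ (0, snd (cd j)) = j"
      by blast
  next
    fix f :: "nat \<Rightarrow> real"
    have "(\<Sum>r<b * 2. f r) = (\<Sum>j<b. \<Sum>r | r \<in> {..<b * 2} \<and> R $$ (0, r) = j. f r)"
      using blocked_mepD(2)[OF R] by (intro sum.group[symmetric]) auto
    also have "\<dots> = (\<Sum>j<b. f (fst (cd j)) + f (snd (cd j)))"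
      using block by (intro sum.cong) auto
    finally show "(\<Sum>r<b * 2. f r) = (\<Sum>j<b. f (fst (cd j)) + f (snd (cd j)))" .
  qed
qed

text \<open>
  The edges \<open>{f j, g j}\<close> form a multigraph, possibly with loops, of average degree at most \<open>v - 2\<close>. If
  some degree is at most \<open>v - 3\<close>, the contrast between this vertex \<open>p\<close> and all others
  varies by at most \<open>v\<^sup>2 (v - 3)\<close> and has squared norm \<open>v (v - 1)\<close>. Otherwise the
  graph is regular of degree \<open>v - 2\<close>, and since \<open>v - 2 < v - 1\<close> the vertex \<open>0\<close> has a non-neighbour \<open>q\<close>; the
  contrast between \<open>0\<close> and \<open>q\<close> then varies by \<open>2 (v - 2)\<close> and has squared norm \<open>2\<close>.
\<close>

lemma edges_with_small_variation:
  fixes f g :: "nat \<Rightarrow> nat" and v b :: nat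
  assumes v: "3 \<le> v" and b: "2 * b \<le> v * (v - 2)"
    and f: "\<And>j. j < b \<Longrightarrow> f j < v" and g: "\<And>j. j < b \<Longrightarrow> g j < v"
  shows "\<exists>x :: nat \<Rightarrow> real. (\<Sum>p<v. x p) = 0 \<and> (\<Sum>p<v. (x p)\<^sup>2) > 0 \<and>
    (\<Sum>j<b. (x (f j) - x (g j))\<^sup>2) \<le> (real v - 2) * (\<Sum>p<v. (x p)\<^sup>2)"
proof -
  define e where "e j p = (if f j = g j then 0 else of_bool (f j = p) + of_bool (g j = p) :: nat)" for j p
  define deg where "deg p = (\<Sum>j<b. e j p)" for p
  show ?thesis
  proof (cases "\<exists>p<v. deg p \<le> v - 3")
    case True
    then obtain p where p: "p < v" "deg p \<le> v - 3" by blast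
    \<comment> \<open>Each non-loop edge at \<open>p\<close> contributes \<open>v\<^sup>2\<close> to the variation, all other edges contribute \<open>0\<close>.\<close>
    define x where "x q = (if q = p then real v - 1 else - 1)" for q
    have ind: "(\<Sum>q<v. if q = p then c else 0) = c" for c :: real using p by simp
    have "(\<Sum>q<v. x q) = (\<Sum>q<v. (if q = p then real v else 0) - 1)"
      by (intro sum.cong) (auto simp: x_def)
    hence sum: "(\<Sum>q<v. x q) = 0" by (simp add: sum_subtractf ind)
    have "(\<Sum>q<v. (x q)\<^sup>2) = (\<Sum>q<v. (if q = p then (real v - 1)\<^sup>2 - 1 else 0) + 1)"
      by (intro sum.cong) (auto simp: x_def)
    hence sq: "(\<Sum>q<v. (x q)\<^sup>2) = real v * (real v - 1)"
      by (simp add: sum.distrib ind) (simp add: power2_eq_square algebra_simps)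
    have "(\<Sum>j<b. (x (f j) - x (g j))\<^sup>2) = (\<Sum>j<b. (real v)\<^sup>2 * real (e j p))"
      by (intro sum.cong refl) (auto simp: x_def e_def power2_commute)
    also have "\<dots> = (real v)\<^sup>2 * real (deg p)" by (simp add: deg_def sum_distrib_left)
    also have "\<dots> \<le> (real v)\<^sup>2 * real (v - 3)" using p by (intro mult_left_mono) auto
    also have "\<dots> \<le> (real v - 2) * (real v * (real v - 1))"
      using v by (simp add: of_nat_diff power2_eq_square algebra_simps)
    finally show ?thesis using sum sq v by (intro exI[of _ x]) simp
  next
    case False
    hence ge: "v - 2 \<le> deg p" if "p < v" for p using that v by force
    \<comment> \<open>Every edge that is not a loop is counted at its two ends.\<close>
    have handshake: "(\<Sum>p<v. deg p) \<le> 2 * b"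
    proof -
      have "(\<Sum>p<v. deg p) = (\<Sum>j<b. \<Sum>p<v. e j p)" unfolding deg_def by (rule sum.swap)
      also have "\<dots> \<le> (\<Sum>j<b. 2)"
      proof (rule sum_mono)
        fix j assume "j \<in> {..<b}"
        hence "f j < v" "g j < v" using f g by auto
        thus "(\<Sum>p<v. e j p) \<le> 2" 
          by (cases "f j = g j") (auto simp: e_def sum.distrib of_bool_def)
      qed
      finally show ?thesis by simp
    qed
    have deg: "deg p = v - 2" if p: "p < v" for p
    proof (rule ccontr)
      assume "deg p \<noteq> v - 2"
      hence "v - 2 < deg p" using ge[OF p] by simp
      hence "(\<Sum>q<v. v - 2) < (\<Sum>q<v. deg q)" using p ge by (intro sum_strict_mono_ex1) auto
      thus False using handshake b by simp
    qed
    define J where "J = {j. j < b \<and> f j \<noteq> g j \<and> (f j = 0 \<or> g j = 0)}"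
    define nb where "nb j = (if f j = 0 then g j else f j)" for j
    have "deg 0 = (\<Sum>j<b. of_bool (f j \<noteq> g j \<and> (f j = 0 \<or> g j = 0)))"
      unfolding deg_def by (intro sum.cong) (auto simp: e_def)
    also have "\<dots> = card J" by (simp add: J_def of_bool_def sum.If_cases Int_def)
    finally have "card J = v - 2" using deg[of 0] v by simp
    moreover have "finite J" by (simp add: J_def)
    ultimately have "card (nb ` J) < card {1..<v}" using card_image_le[of J nb] v by simp
    hence "\<not> {1..<v} \<subseteq> nb ` J" using \<open>finite J\<close> by (meson card_mono finite_imageI not_le)
    then obtain q where q: "0 < q" "q < v" "q \<notin> nb ` J"
      by (metis atLeastLessThan_iff less_eq_Suc_le One_nat_def subsetI)
    define x where "x r = of_bool (r = 0) - (of_bool (r = q) :: real)" for r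
    have sum: "(\<Sum>r<v. x r) = 0" using q v by (simp add: x_def sum_subtractf of_bool_def)
    have "(\<Sum>r<v. (x r)\<^sup>2) = (\<Sum>r<v. of_bool (r = 0) + of_bool (r = q))"
      using q by (intro sum.cong) (auto simp: x_def)
    hence sq: "(\<Sum>r<v. (x r)\<^sup>2) = 2" using q v by (simp add: sum.distrib of_bool_def)
    have "(\<Sum>j<b. (x (f j) - x (g j))\<^sup>2) = (\<Sum>j<b. real (e j 0) + real (e j q))"
    proof (rule sum.cong)
      fix j assume j: "j \<in> {..<b}"
      have "\<not> (f j = 0 \<and> g j = q) \<and> \<not> (f j = q \<and> g j = 0)"
        using q j by (auto simp: J_def nb_def image_iff)
      thus "(x (f j) - x (g j))\<^sup>2 = real (e j 0) + real (e j q)"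
        using q by (auto simp: x_def e_def)
    qed simp
    also have "\<dots> = real (deg 0) + real (deg q)" by (simp add: deg_def sum.distrib)
    also have "\<dots> = (real v - 2) * 2" using deg[of 0] deg[of q] q v by (simp add: of_nat_diff)
    finally show ?thesis using sum sq by (intro exI[of _ x]) simp
  qed
qed

text \<open>
  The first part turns a test contrast into an upper bound for the eigenvalue. The second part
  provides an eigenvector, on which a lower bound for the form is a lower bound for the eigenvalue.
\<close>

lemma information_contrast_eigenvalue_rayleigh:
  assumes R: "blocked_mep m s b k R" and i: "i \<in> {1..m}"
    and x0: "(\<Sum>p<s i. x p) = 0" and x1: "(\<Sum>p<s i. (x p)\<^sup>2) > 0"
  shows "smallest_contrast_eigenvalue (information_mat m s b R i) * (\<Sum>p<s i. (x p)\<^sup>2)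
      \<le> vec (s i) x \<bullet> (information_mat m s b R i *\<^sub>v vec (s i) x)"
    and "\<exists>y. (\<Sum>p<s i. y p) = 0 \<and> (\<Sum>p<s i. (y p)\<^sup>2) > 0 \<and>
      vec (s i) y \<bullet> (information_mat m s b R i *\<^sub>v vec (s i) y)
        = smallest_contrast_eigenvalue (information_mat m s b R i) * (\<Sum>p<s i. (y p)\<^sup>2)"
proof -
  let ?C = "information_mat m s b R i"
  have vec: "vec (s i) x \<in> carrier_vec (s i)" by simp
  have norm: "vec (s i) x \<bullet> vec (s i) x = (\<Sum>p<s i. (x p)\<^sup>2)"
    by (simp add: square_norm_as_sum[OF vec])
  have nz: "vec (s i) x \<noteq> 0\<^sub>v (s i)" using norm x1 by auto
  have ctr: "vec (s i) x \<bullet> vec (s i) (\<lambda>_. 1) = 0" using x0 by (simp add: contrast_as_sum[OF vec])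
  note sce = smallest_contrast_eigenvalue_rayleigh[OF information_mat_carrier[of m s b R i]
      information_mat_self_adjoint information_mat_mult_ones[OF R i] vec nz ctr]
  show "smallest_contrast_eigenvalue ?C * (\<Sum>p<s i. (x p)\<^sup>2) \<le> vec (s i) x \<bullet> (?C *\<^sub>v vec (s i) x)"
    using sce(1) unfolding norm by blast
  from sce(2) obtain v where v: "v \<in> carrier_vec (s i)" "v \<noteq> 0\<^sub>v (s i)" "v \<bullet> vec (s i) (\<lambda>_. 1) = 0"
    "v \<bullet> (?C *\<^sub>v v) = smallest_contrast_eigenvalue ?C * (v \<bullet> v)"
    by blast
  define y where "y p = v $ p" for p
  have vy: "vec (s i) y = v" using v by (intro eq_vecI) (auto simp: y_def)
  have "(\<Sum>p<s i. (y p)\<^sup>2) = v \<bullet> v" by (simp add: square_norm_as_sum[OF v(1)] y_def)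
  moreover have "v \<bullet> v > 0"
    using v scalar_prod_self_eq_0[of v] scalar_prod_self_nonneg[of v] by (auto simp: less_le)
  moreover have "(\<Sum>p<s i. y p) = 0" using v(3) by (simp add: contrast_as_sum[OF v(1)] y_def)
  ultimately show "\<exists>y. (\<Sum>p<s i. y p) = 0 \<and> (\<Sum>p<s i. (y p)\<^sup>2) > 0 \<and>
      vec (s i) y \<bullet> (?C *\<^sub>v vec (s i) y) = smallest_contrast_eigenvalue ?C * (\<Sum>p<s i. (y p)\<^sup>2)"
    using v vy by (intro exI[of _ y]) simp
qed

text \<open>
  The blocks are the edges of the multigraph of factor \<open>i\<close>. The block averages of a contrast
  of small variation bound the information form, and thereby the eigenvalue, from above.
\<close>

lemma contrast_eigenvalue_upper_bound:
  assumes R: "blocked_mep m s b 2 R" and i: "i \<in> {1..m}"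
    and v: "3 \<le> s i" and b: "2 * b \<le> s i * (s i - 2)"
  shows "smallest_contrast_eigenvalue (information_mat m s b R i) \<le> (real (s i) - 2) / 2"
proof -
  obtain c d where cd: "\<And>j. j < b \<Longrightarrow> c j < b * 2 \<and> d j < b * 2 \<and> R $$ (0, c j) = j \<and> R $$ (0, d j) = j"
    and sum: "\<And>f :: nat \<Rightarrow> real. (\<Sum>r<b * 2. f r) = (\<Sum>j<b. f (c j) + f (d j))"
    by (rule run_pairs_of_blocks[OF R], rule that)
  define f g where "f j = R $$ (i, c j)" and "g j = R $$ (i, d j)" for j
  have "f j < s i" "g j < s i" if "j < b" for j
    using cd[OF that] blocked_mepD(3)[OF R i] by (auto simp: f_def g_def)
  then obtain x :: "nat \<Rightarrow> real" where x0: "(\<Sum>p<s i. x p) = 0" and x1: "(\<Sum>p<s i. (x p)\<^sup>2) > 0"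
    and xv: "(\<Sum>j<b. (x (f j) - x (g j))\<^sup>2) \<le> (real (s i) - 2) * (\<Sum>p<s i. (x p)\<^sup>2)"
    using edges_with_small_variation[OF v b, of f g] by blast
  \<comment> \<open>The block average is the best constant for the two runs of a block.\<close>
  define a where "a j = (x (f j) + x (g j)) / 2" for j
  have "smallest_contrast_eigenvalue (information_mat m s b R i) * (\<Sum>p<s i. (x p)\<^sup>2)
      \<le> vec (s i) x \<bullet> (information_mat m s b R i *\<^sub>v vec (s i) x)"
    by (rule information_contrast_eigenvalue_rayleigh(1)[OF R i x0 x1])
  also have "\<dots> \<le> (\<Sum>r<b * 2. (x (R $$ (i, r)) - a (R $$ (0, r)))\<^sup>2)"
    by (rule information_form_le_block_residuals[OF R i])
  also have "\<dots> = (\<Sum>j<b. (x (f j) - x (g j))\<^sup>2 / 2)"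
    unfolding sum using cd
    by (intro sum.cong) (auto simp: f_def[symmetric] g_def[symmetric] a_def power2_eq_square field_simps)
  also have "\<dots> \<le> (real (s i) - 2) / 2 * (\<Sum>p<s i. (x p)\<^sup>2)"
    using xv by (simp add: sum_divide_distrib[symmetric])
  finally show ?thesis using x1 by simp
qed

section \<open>Plans with blocks of size two\<close>

definition two_run_plan :: "nat \<Rightarrow> nat \<Rightarrow> (nat \<Rightarrow> nat \<Rightarrow> nat \<Rightarrow> nat) \<Rightarrow> nat mat" where
  "two_run_plan m b f = mat (m + 1) (b * 2) (\<lambda>(i, c). if i = 0 then c div 2 else f (c mod 2) (c div 2) i)"

lemma sum_over_run_pairs:
  "(\<Sum>c<b * 2. h c) = (\<Sum>B<b. h (2 * B) + h (2 * B + 1) :: 'a :: comm_monoid_add)" for b :: nat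
  by (induction b) (simp_all add: ac_simps)

lemma card_as_sum: "card {c. c < n \<and> P c} = (\<Sum>c<n. of_bool (P c))" for n :: nat
  by (simp add: of_bool_def sum.If_cases Int_def)

lemma two_run_plan_dims [simp]:
  "dim_col (two_run_plan m b f) = b * 2" "dim_row (two_run_plan m b f) = m + 1"
  by (simp_all add: two_run_plan_def)

lemma two_run_plan_block_index [simp]:
  "c < b * 2 \<Longrightarrow> two_run_plan m b f $$ (0, c) = c div 2"
  by (simp add: two_run_plan_def)

lemma two_run_plan_index [simp]:
  "c < b * 2 \<Longrightarrow> i \<in> {1..m} \<Longrightarrow> two_run_plan m b f $$ (i, c) = f (c mod 2) (c div 2) i"
  by (simp add: two_run_plan_def)

lemma two_run_plan_blocks:
  "j < b \<Longrightarrow> {c. c < b * 2 \<and> two_run_plan m b f $$ (0, c) = j} = {2 * j, 2 * j + 1}"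
  by (auto simp: two_run_plan_def)

lemma two_run_plan_blocked_mep:
  assumes "1 \<le> m" "1 \<le> b" and f: "\<And>e B i. B < b \<Longrightarrow> i \<in> {1..m} \<Longrightarrow> f e B i < s i"
  shows "blocked_mep m s b 2 (two_run_plan m b f)"
  unfolding blocked_mep_def
proof (intro conjI allI impI ballI)
  show "two_run_plan m b f \<in> carrier_mat (m + 1) (b * 2)" by (simp add: two_run_plan_def)
  show "card {c. c < b * 2 \<and> two_run_plan m b f $$ (0, c) = j} = 2" if "j < b" for j
    unfolding two_run_plan_blocks[OF that] by simp
qed (use assms in auto)

lemma two_run_plan_block_mat:
  assumes "i \<in> {1..m}" "p < s i" "B < b"
  shows "block_mat s b (two_run_plan m b f) i $$ (p, B) = of_bool (f 0 B i = p) + of_bool (f 1 B i = p)"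
proof -
  have "block_mat s b (two_run_plan m b f) i $$ (p, B)
    = card {c. c < b * 2 \<and> two_run_plan m b f $$ (i, c) = p \<and> two_run_plan m b f $$ (0, c) = B}"
    using assms by (simp add: block_mat_def count_mat_def)
  also have "\<dots> = card {c. c < b * 2 \<and> f (c mod 2) (c div 2) i = p \<and> c div 2 = B}"
    using assms by (intro arg_cong[of _ _ card]) auto
  also have "\<dots> = (\<Sum>B'<b. if B' = B then of_bool (f 0 B i = p) + of_bool (f 1 B i = p) else 0)"
    unfolding card_as_sum sum_over_run_pairs by (intro sum.cong) auto
  also have "\<dots> = of_bool (f 0 B i = p) + of_bool (f 1 B i = p)" using assms by simp
  finally show ?thesis .
qed

text \<open>
  In \<open>M\<^sub>i\<^sub>B M\<^sub>j\<^sub>B'\<close> every ordered pair of runs of a block is counted, in \<open>M\<^sub>i\<^sub>j\<close> only a run with itself. Hence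
  the mixed pairs have to make up for the factor \<open>2\<close>.
\<close>

lemma two_run_plan_orthogonal:
  assumes i: "i \<in> {1..m}" and j: "j \<in> {1..m}"
    and swap: "\<And>p q. p < s i \<Longrightarrow> q < s j \<Longrightarrow>
      (\<Sum>B<b. of_bool (f 0 B i = p \<and> f 1 B j = q) + of_bool (f 1 B i = p \<and> f 0 B j = q) :: nat)
      = (\<Sum>B<b. of_bool (f 0 B i = p \<and> f 0 B j = q) + of_bool (f 1 B i = p \<and> f 1 B j = q))"
  shows "orthogonal_through_block s b 2 (two_run_plan m b f) i j"
  unfolding orthogonal_through_block_def
proof (rule eq_matI)
  let ?A = "two_run_plan m b f"
  fix p q assume "p < dim_row (2 \<cdot>\<^sub>m factor_mat s ?A i j)" "q < dim_col (2 \<cdot>\<^sub>m factor_mat s ?A i j)"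
  hence pq: "p < s i" "q < s j" by (auto simp: factor_mat_def count_mat_def)
  have "(block_mat s b ?A i * transpose_mat (block_mat s b ?A j)) $$ (p, q)
    = (\<Sum>B<b. block_mat s b ?A i $$ (p, B) * block_mat s b ?A j $$ (q, B))"
    using pq by (simp add: block_mat_def count_mat_def scalar_prod_def atLeast0LessThan)
  also have "\<dots> = (\<Sum>B<b. (of_bool (f 0 B i = p \<and> f 1 B j = q) + of_bool (f 1 B i = p \<and> f 0 B j = q))
      + (of_bool (f 0 B i = p \<and> f 0 B j = q) + of_bool (f 1 B i = p \<and> f 1 B j = q)))"
    using i j pq by (intro sum.cong refl) (simp add: two_run_plan_block_mat of_bool_def)
  also have "\<dots> = 2 * (\<Sum>B<b. of_bool (f 0 B i = p \<and> f 0 B j = q) + of_bool (f 1 B i = p \<and> f 1 B j = q))"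
    using swap[OF pq] by (simp only: sum.distrib mult_2)
  also have "(\<Sum>B<b. of_bool (f 0 B i = p \<and> f 0 B j = q) + of_bool (f 1 B i = p \<and> f 1 B j = q))
    = card {c. c < b * 2 \<and> f (c mod 2) (c div 2) i = p \<and> f (c mod 2) (c div 2) j = q}"
    unfolding card_as_sum sum_over_run_pairs by simp
  also have "\<dots> = card {c. c < b * 2 \<and> ?A $$ (i, c) = p \<and> ?A $$ (j, c) = q}"
    using i j by (intro arg_cong[of _ _ card]) auto
  also have "2 * \<dots> = (2 \<cdot>\<^sub>m factor_mat s ?A i j) $$ (p, q)"
    using pq by (simp add: factor_mat_def count_mat_def)
  finally show "(block_mat s b ?A i * transpose_mat (block_mat s b ?A j)) $$ (p, q)
    = (2 \<cdot>\<^sub>m factor_mat s ?A i j) $$ (p, q)" .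
qed (simp_all add: block_mat_def factor_mat_def count_mat_def)

lemma two_run_plan_information_form:
  fixes x :: "nat \<Rightarrow> real"
  assumes potb: "potb m s b 2 (two_run_plan m b f)" and i: "i \<in> {1..m}"
  shows "vec (s i) x \<bullet> (information_mat m s b (two_run_plan m b f) i *\<^sub>v vec (s i) x)
    = (\<Sum>B<b. (x (f 0 B i) - x (f 1 B i))\<^sup>2) / 2"
proof -
  let ?A = "two_run_plan m b f"
  have avg: "(\<Sum>c | c < b * 2 \<and> ?A $$ (0, c) = B. x (f (c mod 2) (c div 2) i)) = x (f 0 B i) + x (f 1 B i)" if "B < b" for B
    unfolding two_run_plan_blocks[OF that] using that i by simp
  have "vec (s i) x \<bullet> (information_mat m s b ?A i *\<^sub>v vec (s i) x)
    = (\<Sum>B<b. (x (f 0 B i) - (x (f 0 B i) + x (f 1 B i)) / 2)\<^sup>2 + (x (f 1 B i) - (x (f 0 B i) + x (f 1 B i)) / 2)\<^sup>2)"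
    unfolding potb_information_form[OF potb i] sum_over_run_pairs
    using i by (intro sum.cong refl) (simp add: avg)
  also have "\<dots> = (\<Sum>B<b. (x (f 0 B i) - x (f 1 B i))\<^sup>2 / 2)"
    by (intro sum.cong refl) (simp add: power2_eq_square field_simps)
  finally show ?thesis by (simp add: sum_divide_distrib)
qed

section \<open>Cyclic development of the initial blocks\<close>

text \<open>
  The entry in row \<open>t\<close> and column \<open>i\<close>, with columns numbered from \<open>1\<close> as the factors are, is the
  difference of the levels of factor \<open>i\<close> in the two runs of initial block \<open>t\<close>. The rows are those of a
  quaternionic orthogonal design: signed permutations of \<open>1, 2, 3, 4\<close> with pairwise orthogonal columns.
\<close>

definition run_difference :: "nat \<Rightarrow> nat \<Rightarrow> int" where
  "run_difference t i = [[1, 2, 3, 4], [2, -1, 4, -3], [3, -4, -1, 2], [4, 3, -2, -1]] ! t ! (i - 1)"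

text \<open>
  The level of factor \<open>i\<close> in run \<open>e \<in> {0, 1}\<close> of initial block \<open>t\<close>. The two levels have midpoint
  \<open>\<mu> = ([i odd] + [t odd]) / 2\<close>, whose differences between factors do not depend on \<open>t\<close>. Because the
  parities of the design form a checkerboard, \<open>2 \<mu>\<close> and the run difference have the same parity and
  the division is exact.
\<close>

definition base_level :: "nat \<Rightarrow> nat \<Rightarrow> nat \<Rightarrow> int" where
  "base_level e t i = (of_bool (odd i) + of_bool (odd t) - run_difference t i) div 2 + int e * run_difference t i"

text \<open>
  The residue of \<open>a + z\<close> modulo \<open>n\<close>, as a level. A pair of residues moves through all its
  translates as \<open>z\<close> runs through \<open>{..<n}\<close>, so sums over \<open>z\<close> depend on the difference of the pair only.
\<close>

definition shifted :: "nat \<Rightarrow> int \<Rightarrow> nat \<Rightarrow> nat" where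
  "shifted n a z = nat ((a + int z) mod int n)"

text \<open>
  Block \<open>t n + z\<close> is the translate by \<open>z\<close> of initial block \<open>t\<close>. The number \<open>u\<close> of initial blocks is also
  the number of factors.
\<close>

definition cyclic_plan :: "nat \<Rightarrow> nat \<Rightarrow> nat mat" where
  "cyclic_plan n u = two_run_plan u (u * n) (\<lambda>e B i. shifted n (base_level e (B div n) i) (B mod n))"

lemma sum_over_shifts:
  fixes h :: "nat \<Rightarrow> nat \<Rightarrow> 'a :: comm_monoid_add"
  shows "(\<Sum>B<u * n. h (B div n) (B mod n)) = (\<Sum>t<u. \<Sum>z<n. h t z)"
proof -
  have "(\<Sum>B<u * n. h (B div n) (B mod n)) = (\<Sum>t<u. \<Sum>B=t * n..<t * n + n. h (B div n) (B mod n))"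
    by (rule sum.nat_group[symmetric])
  also have "\<dots> = (\<Sum>t<u. \<Sum>z<n. h t z)"
  proof (rule sum.cong[OF refl])
    fix t
    have "(\<Sum>B=t * n..<t * n + n. h (B div n) (B mod n)) = (\<Sum>z=0..<n. h ((z + t * n) div n) ((z + t * n) mod n))"
      using sum.shift_bounds_nat_ivl[of "\<lambda>B. h (B div n) (B mod n)" 0 "t * n" n] by (simp add: add.commute)
    thus "(\<Sum>B=t * n..<t * n + n. h (B div n) (B mod n)) = (\<Sum>z<n. h t z)"
      by (simp add: atLeast0LessThan)
  qed
  finally show ?thesis .
qed

lemma shifted_less: "0 < n \<Longrightarrow> shifted n a z < n"
  by (simp add: shifted_def nat_less_iff)

lemma shifted_eq_iff:
  assumes "p < n"
  shows "shifted n a z = p \<longleftrightarrow> [a + int z = int p] (mod int n)"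
  using assms by (auto simp: shifted_def cong_def nat_eq_iff2 zmod_int)

lemma bij_betw_shifted: "0 < n \<Longrightarrow> bij_betw (shifted n a) {..<n} {..<n}"
proof -
  assume n: "0 < n"
  have "inj_on (shifted n a) {..<n}"
  proof (rule inj_onI)
    fix y z assume yz: "y \<in> {..<n}" "z \<in> {..<n}" "shifted n a y = shifted n a z"
    hence "[a + int y = a + int z] (mod int n)"
      using n by (simp add: shifted_def cong_def eq_nat_nat_iff)
    hence "[int y = int z] (mod int n)" by (simp add: cong_add_lcancel)
    thus "y = z" using yz by (simp add: cong_def)
  qed
  moreover have "shifted n a ` {..<n} \<subseteq> {..<n}" using shifted_less[OF n] by auto
  ultimately show ?thesis by (simp add: bij_betw_def endo_inj_surj)
qed

lemma shifted_shifted: "0 < n \<Longrightarrow> shifted n d (shifted n a z) = shifted n (a + d) z"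
  by (simp add: shifted_def mod_simps ac_simps)

lemma sum_shifted_pairs:
  assumes n: "0 < n"
  shows "(\<Sum>z<n. h (shifted n a z) (shifted n c z)) = (\<Sum>z<n. h z (shifted n (c - a) z))"
proof -
  have "(\<Sum>z<n. h (shifted n a z) (shifted n c z))
      = (\<Sum>z<n. (\<lambda>y. h y (shifted n (c - a) y)) (shifted n a z))"
    using n by (simp add: shifted_shifted)
  also have "\<dots> = (\<Sum>z<n. h z (shifted n (c - a) z))"
    by (rule sum.reindex_bij_betw[OF bij_betw_shifted[OF n]])
  finally show ?thesis .
qed

lemma count_shifted_pairs:
  assumes "p < n" "q < n"
  shows "(\<Sum>z<n. of_bool (shifted n a z = p \<and> shifted n c z = q) :: nat)
    = of_bool ([c - a = int q - int p] (mod int n))"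
proof -
  have "(\<Sum>z<n. of_bool (shifted n a z = p \<and> shifted n c z = q) :: nat)
      = (\<Sum>z<n. of_bool (z = p \<and> shifted n (c - a) z = q))"
    using assms by (intro sum_shifted_pairs) auto
  also have "\<dots> = (\<Sum>z<n. if z = p then of_bool (shifted n (c - a) p = q) else 0)"
    by (intro sum.cong) auto
  also have "\<dots> = of_bool (shifted n (c - a) p = q)" using assms by simp
  also have "shifted n (c - a) p = q \<longleftrightarrow> [c - a = int q - int p] (mod int n)"
    unfolding shifted_eq_iff[OF assms(2)] cong_iff_dvd_diff by (simp add: algebra_simps)
  finally show ?thesis .
qed

lemma count_developed_pairs:
  assumes "p < n" "q < n"
  shows "(\<Sum>B<u * n. of_bool (shifted n (\<alpha> (B div n)) (B mod n) = p \<and> shifted n (\<gamma> (B div n)) (B mod n) = q) :: nat)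
    = (\<Sum>t<u. of_bool ([\<gamma> t - \<alpha> t = int q - int p] (mod int n)))"
  unfolding sum_over_shifts[of "\<lambda>t z. of_bool (shifted n (\<alpha> t) z = p \<and> shifted n (\<gamma> t) z = q)"]
    count_shifted_pairs[OF assms] ..

text \<open>
  The defining property of the initial blocks: for two factors, swapping levels between the two runs
  of each block permutes the differences over all blocks. The function \<open>h\<close> encodes equality of multisets.
\<close>

lemma base_level_differences:
  fixes h :: "int \<Rightarrow> nat"
  assumes "u = 2 \<or> u = 4" "i \<in> {1..u}" "j \<in> {1..u}" "i \<noteq> j"
  shows "(\<Sum>t<u. h (base_level 1 t j - base_level 0 t i) + h (base_level 0 t j - base_level 1 t i))
       = (\<Sum>t<u. h (base_level 0 t j - base_level 0 t i) + h (base_level 1 t j - base_level 1 t i))"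
proof -
  have "i = 1 \<or> i = 2 \<or> i = 3 \<or> i = 4" "j = 1 \<or> j = 2 \<or> j = 3 \<or> j = 4" using assms by auto
  moreover have "(\<Sum>t<2. g t) = g 0 + g 1" "(\<Sum>t<4. g t) = g 0 + g 1 + g 2 + g 3" for g :: "nat \<Rightarrow> nat"
    by (simp_all add: eval_nat_numeral)
  ultimately show ?thesis using assms
    by (elim disjE) (simp_all add: base_level_def run_difference_def)
qed

lemma cyclic_plan_blocked_mep:
  "1 \<le> u \<Longrightarrow> 1 \<le> n \<Longrightarrow> blocked_mep u (\<lambda>_. n) (u * n) 2 (cyclic_plan n u)"
  unfolding cyclic_plan_def by (intro two_run_plan_blocked_mep) (auto intro: shifted_less)

lemma cyclic_plan_potb:
  assumes u: "u = 2 \<or> u = 4" and n: "1 \<le> n"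
  shows "potb u (\<lambda>_. n) (u * n) 2 (cyclic_plan n u)"
  unfolding potb_def
proof (intro conjI ballI impI)
  show "blocked_mep u (\<lambda>_. n) (u * n) 2 (cyclic_plan n u)"
    using u n by (intro cyclic_plan_blocked_mep) auto
  fix i j assume ij: "i \<in> {1..u}" "j \<in> {1..u}" "i \<noteq> j"
  show "orthogonal_through_block (\<lambda>_. n) (u * n) 2 (cyclic_plan n u) i j"
    unfolding cyclic_plan_def
  proof (rule two_run_plan_orthogonal[OF ij(1,2)])
    fix p q assume pq: "p < n" "q < n"
    let ?L = "\<lambda>e B. shifted n (base_level e (B div n) i) (B mod n)"
    let ?M = "\<lambda>e B. shifted n (base_level e (B div n) j) (B mod n)"
    have count: "(\<Sum>B<u * n. of_bool (?L e B = p \<and> ?M e' B = q) :: nat)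
      = (\<Sum>t<u. of_bool ([base_level e' t j - base_level e t i = int q - int p] (mod int n)))" for e e'
      using pq by (rule count_developed_pairs)
    show "(\<Sum>B<u * n. of_bool (?L 0 B = p \<and> ?M 1 B = q) + of_bool (?L 1 B = p \<and> ?M 0 B = q) :: nat)
      = (\<Sum>B<u * n. of_bool (?L 0 B = p \<and> ?M 0 B = q) + of_bool (?L 1 B = p \<and> ?M 1 B = q))"
      unfolding sum.distrib count
      using base_level_differences[OF u ij, of "\<lambda>d. of_bool ([d = int q - int p] (mod int n))"]
      by (simp add: sum.distrib)
  qed
qed

section \<open>Connectedness and balance\<close>

lemma base_level_step: "base_level 1 t i = base_level 0 t i + run_difference t i"
  by (simp add: base_level_def)

lemma cyclic_plan_block_mat:
  assumes "i \<in> {1..u}" "p < n" "t < u" "z < n"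
  shows "block_mat (\<lambda>_. n) (u * n) (cyclic_plan n u) i $$ (p, t * n + z)
    = of_bool (shifted n (base_level 0 t i) z = p) + of_bool (shifted n (base_level 1 t i) z = p)"
proof -
  have "t * n + z < (t + 1) * n" using assms by simp
  also have "\<dots> \<le> u * n" using assms by (intro mult_right_mono) auto
  finally have "t * n + z < u * n" .
  thus ?thesis using assms unfolding cyclic_plan_def
    by (subst two_run_plan_block_mat) (auto simp: div_add1_eq)
qed

lemma cyclic_plan_adjacent:
  assumes i: "i \<in> {1..u}" and t: "t < u" and p: "p < n" and q: "q < n" and "p \<noteq> q"
    and pq: "[run_difference t i = int q - int p] (mod int n)"
  shows "(p, q) \<in> level_adjacency (block_mat (\<lambda>_. n) (u * n) (cyclic_plan n u) i)"
    and "(q, p) \<in> level_adjacency (block_mat (\<lambda>_. n) (u * n) (cyclic_plan n u) i)"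
proof -
  let ?N = "block_mat (\<lambda>_. n) (u * n) (cyclic_plan n u) i"
  have dims: "dim_row ?N = n" "dim_col ?N = u * n" by (simp_all add: block_mat_def count_mat_def)
  have "p \<in> shifted n (base_level 0 t i) ` {..<n}"
    using bij_betw_shifted[of n "base_level 0 t i"] p by (auto simp: bij_betw_def)
  then obtain z where z: "z < n" "shifted n (base_level 0 t i) z = p" by auto
  have "[base_level 0 t i + int z + run_difference t i = int p + (int q - int p)] (mod int n)"
    using z p pq by (intro cong_add) (auto simp: shifted_eq_iff)
  hence z': "shifted n (base_level 1 t i) z = q"
    unfolding shifted_eq_iff[OF q] base_level_step by (simp add: ac_simps)
  have "?N $$ (p, t * n + z) > 0" "?N $$ (q, t * n + z) > 0"
    using cyclic_plan_block_mat[OF i p t z(1)] cyclic_plan_block_mat[OF i q t z(1)] z z' by simp_all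
  moreover have "t * n + z < u * n"
  proof -
    have "t * n + z < (t + 1) * n" using z by simp
    also have "\<dots> \<le> u * n" using t by (intro mult_right_mono) auto
    finally show ?thesis .
  qed
  ultimately show "(p, q) \<in> level_adjacency ?N" "(q, p) \<in> level_adjacency ?N"
    using p q \<open>p \<noteq> q\<close> unfolding level_adjacency_def dims by blast+
qed

text \<open>
  In block \<open>i - 1\<close> factor \<open>i\<close> has difference \<open>\<plusminus>1\<close>, the diagonal of the design, so consecutive levels are
  adjacent.
\<close>

lemma cyclic_plan_connected:
  assumes u: "u = 2 \<or> u = 4" and n: "1 \<le> n"
  shows "connected_mep u (\<lambda>_. n) (u * n) 2 (cyclic_plan n u)"
  unfolding connected_mep_def
proof (intro conjI ballI)
  show "blocked_mep u (\<lambda>_. n) (u * n) 2 (cyclic_plan n u)"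
    using u n by (intro cyclic_plan_blocked_mep) auto
  fix i assume i: "i \<in> {1..u}"
  let ?N = "block_mat (\<lambda>_. n) (u * n) (cyclic_plan n u) i"
  have "i = 1 \<or> i = 2 \<or> i = 3 \<or> i = 4" using i u by auto
  hence d: "run_difference (i - 1) i = 1 \<or> run_difference (i - 1) i = - 1"
    by (elim disjE) (simp_all add: run_difference_def)
  have step: "(p, Suc p) \<in> level_adjacency ?N \<and> (Suc p, p) \<in> level_adjacency ?N" if "Suc p < n" for p
    using d cyclic_plan_adjacent[OF i, of "i - 1" p n "Suc p"] cyclic_plan_adjacent[OF i, of "i - 1" "Suc p" n p] that i
    by auto
  have from0: "(0, p) \<in> (level_adjacency ?N)\<^sup>* \<and> (p, 0) \<in> (level_adjacency ?N)\<^sup>*" if "p < n" for p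
    using that
  proof (induction p)
    case (Suc p)
    thus ?case using step[of p] by (auto intro: rtrancl_into_rtrancl converse_rtrancl_into_rtrancl)
  qed simp
  show "connected_design ?N"
    unfolding connected_design_def
    using from0 by (auto simp: block_mat_def count_mat_def intro: rtrancl_trans[of _ 0])
qed

text \<open>
  The run differences of each factor are \<open>\<plusminus>1\<close> and \<open>\<plusminus>2\<close>, so modulo \<open>5\<close> each difference of distinct levels
  occurs in exactly one initial block and one order of its runs.
\<close>

lemma cyclic_plan_5_bibd:
  assumes i: "i \<in> {1..2}"
  shows "bibd_incidence 2 (block_mat (\<lambda>_. 5) (2 * 5) (cyclic_plan 5 2) i)"
proof -
  define N where "N = block_mat (\<lambda>_. 5) (2 * 5) (cyclic_plan 5 2) i"
  define L where "L e B = shifted 5 (base_level e (B div 5) i) (B mod 5)" for e B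
  have N_index: "N $$ (p, B) = of_bool (L 0 B = p) + of_bool (L 1 B = p)" if "p < 5" "B < 10" for p B
    using that i unfolding N_def L_def cyclic_plan_def by (subst two_run_plan_block_mat) auto
  have L: "L e B < 5" for e B by (simp add: L_def shifted_less)
  have dims: "dim_row N = 5" "dim_col N = 10" by (simp_all add: N_def block_mat_def count_mat_def)
  have i12: "i = 1 \<or> i = 2" using i by auto
  have count: "(\<Sum>B<10. of_bool (L e B = p \<and> L e' B = q) :: nat)
      = of_bool ([base_level e' 0 i - base_level e 0 i = int q - int p] (mod 5))
      + of_bool ([base_level e' 1 i - base_level e 1 i = int q - int p] (mod 5))"
    if "p < 5" "q < 5" for p q e e'
    using count_developed_pairs[OF that, where u = 2 and \<alpha> = "\<lambda>t. base_level e t i" and \<gamma> = "\<lambda>t. base_level e' t i"]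
    by (simp add: L_def lessThan_Suc numeral_2_eq_2)
  have L01: "L 0 B \<noteq> L 1 B" if "B < 10" for B
  proof
    assume eq: "L 0 B = L 1 B"
    define t where "t = B div 5"
    have "t = 0 \<or> t = 1" using that by (auto simp: t_def)
    moreover have "[base_level 0 t i + int (B mod 5) = base_level 1 t i + int (B mod 5)] (mod 5)"
      using eq by (simp add: L_def t_def shifted_def cong_def eq_nat_nat_iff)
    hence "[0 = run_difference t i] (mod 5)"
      unfolding base_level_step cong_iff_dvd_diff by simp
    ultimately show False using i12 by (auto simp: run_difference_def cong_def)
  qed
  have pairs: "card {B. B < 10 \<and> N $$ (p, B) = 1 \<and> N $$ (q, B) = 1} = 1"
    if pq: "p < 5" "q < 5" "p \<noteq> q" for p q
  proof -
    have "card {B. B < 10 \<and> N $$ (p, B) = 1 \<and> N $$ (q, B) = 1}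
      = (\<Sum>B<10. of_bool (L 0 B = p \<and> L 1 B = q) + of_bool (L 0 B = q \<and> L 1 B = p))"
      unfolding card_as_sum using pq by (intro sum.cong refl) (auto simp: N_index)
    also have "\<dots> = 1"
    proof -
      have "p = 0 \<or> p = 1 \<or> p = 2 \<or> p = 3 \<or> p = 4" "q = 0 \<or> q = 1 \<or> q = 2 \<or> q = 3 \<or> q = 4"
        using pq by auto
      thus ?thesis
        unfolding sum.distrib count[OF pq(1,2)] count[OF pq(2,1)]
        using i12 \<open>p \<noteq> q\<close>
        by (elim disjE) (simp_all add: base_level_def run_difference_def cong_def)
    qed
    finally show ?thesis .
  qed
  show ?thesis
    unfolding bibd_incidence_def N_def[symmetric] dims
  proof (intro conjI)
    show "\<forall>p<5. \<forall>B<10. N $$ (p, B) \<in> {0, 1}" using N_index L01 L01[symmetric] by (auto simp: of_bool_def)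
    show "\<forall>B<10. (\<Sum>p<5. N $$ (p, B)) = 2"
    proof (intro allI impI)
      fix B :: nat assume "B < 10"
      hence "(\<Sum>p<5. N $$ (p, B)) = (\<Sum>p<5. of_bool (L 0 B = p) + of_bool (L 1 B = p))"
        by (intro sum.cong refl) (simp add: N_index)
      also have "\<dots> = 2" using L[of 0 B] L[of 1 B] by (simp add: sum.distrib of_bool_def)
      finally show "(\<Sum>p<5. N $$ (p, B)) = 2" .
    qed
    show "\<exists>r. \<forall>p<5. (\<Sum>B<10. N $$ (p, B)) = r"
    proof (intro exI allI impI)
      fix p :: nat assume p: "p < 5"
      hence "(\<Sum>B<10. N $$ (p, B)) = (\<Sum>B<10. of_bool (L 0 B = p) + of_bool (L 1 B = p))"
        by (intro sum.cong refl) (simp add: N_index)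
      also have "\<dots> = 4"
        using count[OF p p, of 0 0] count[OF p p, of 1 1] by (simp add: sum.distrib)
      finally show "(\<Sum>B<10. N $$ (p, B)) = 4" .
    qed
    show "\<exists>l>0. \<forall>p<5. \<forall>q<5. p \<noteq> q \<longrightarrow> card {B. B < 10 \<and> N $$ (p, B) = 1 \<and> N $$ (q, B) = 1} = l"
      using pairs by (intro exI[of _ 1]) auto
  qed auto
qed

section \<open>E-optimality with ten levels\<close>

lemma shift_variation_neg:
  fixes x :: "nat \<Rightarrow> real"
  assumes n: "0 < n"
  shows "(\<Sum>z<n. (x z - x (shifted n (- d) z))\<^sup>2) = (\<Sum>z<n. (x z - x (shifted n d z))\<^sup>2)"
proof -
  have "(\<Sum>z<n. (x z - x (shifted n (- d) z))\<^sup>2) = (\<Sum>z<n. (x (shifted n d z) - x (shifted n 0 z))\<^sup>2)"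
    using sum_shifted_pairs[OF n, of "\<lambda>y z. (x y - x z)\<^sup>2" d 0] by simp
  also have "\<dots> = (\<Sum>z<n. (x z - x (shifted n d z))\<^sup>2)"
  proof (rule sum.cong[OF refl])
    fix z assume "z \<in> {..<n}"
    hence "shifted n 0 z = z" by (simp add: shifted_def)
    thus "(x (shifted n d z) - x (shifted n 0 z))\<^sup>2 = (x z - x (shifted n d z))\<^sup>2"
      by (simp add: power2_commute)
  qed
  finally show ?thesis .
qed

text \<open>
  The left-hand side is the Laplacian form of the complete graph on \<open>10\<close> vertices minus that of the
  matching of antipodal vertices: \<open>10 \<Sum> x\<^sup>2 - (\<Sum> x)\<^sup>2\<close> minus \<open>\<Sum> (x\<^sub>p - x\<^sub>p\<^sub>+\<^sub>5)\<^sup>2\<close>, where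
  \<open>(x\<^sub>p - x\<^sub>p\<^sub>+\<^sub>5)\<^sup>2 = 2 x\<^sub>p\<^sup>2 + 2 x\<^sub>p\<^sub>+\<^sub>5\<^sup>2 - (x\<^sub>p + x\<^sub>p\<^sub>+\<^sub>5)\<^sup>2\<close>.
\<close>

lemma shift_variation_1234:
  fixes x :: "nat \<Rightarrow> real"
  defines "V \<equiv> \<lambda>d. \<Sum>z<10. (x z - x (shifted 10 d z))\<^sup>2"
  shows "V 1 + V 2 + V 3 + V 4
    = 8 * (\<Sum>p<10. (x p)\<^sup>2) - (\<Sum>p<10. x p)\<^sup>2 + (\<Sum>p<5. (x p + x (p + 5))\<^sup>2)"
proof -
  have s10: "(\<Sum>z<10. g z) = g 0 + g 1 + g 2 + g 3 + g 4 + g 5 + g 6 + g 7 + g 8 + g 9"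
    and s5: "(\<Sum>z<5. g z) = g 0 + g 1 + g 2 + g 3 + g 4" for g :: "nat \<Rightarrow> real"
    by (simp_all add: eval_nat_numeral)
  show ?thesis unfolding V_def s10 s5
    by (simp add: shifted_def) (simp add: power2_eq_square algebra_simps)
qed

text \<open>
  For each factor the run differences are \<open>1, 2, 3, 4\<close> up to order and sign.
\<close>

lemma cyclic_plan_10_form:
  fixes x :: "nat \<Rightarrow> real"
  assumes i: "i \<in> {1..4}" and x: "(\<Sum>p<10. x p) = 0"
  shows "4 * (\<Sum>p<10. (x p)\<^sup>2)
    \<le> vec 10 x \<bullet> (information_mat 4 (\<lambda>_. 10) (4 * 10) (cyclic_plan 10 4) i *\<^sub>v vec 10 x)"
proof -
  define V where "V d = (\<Sum>z<10. (x z - x (shifted 10 d z))\<^sup>2)" for d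
  have neg: "V (- d) = V d" for d unfolding V_def by (rule shift_variation_neg) simp
  let ?L = "\<lambda>e B. shifted 10 (base_level e (B div 10) i) (B mod 10)"
  have "(\<Sum>B<4 * 10. (x (?L 0 B) - x (?L 1 B))\<^sup>2)
    = (\<Sum>t<4. \<Sum>z<10. (x (shifted 10 (base_level 0 t i) z) - x (shifted 10 (base_level 1 t i) z))\<^sup>2)"
    by (rule sum_over_shifts)
  also have "\<dots> = (\<Sum>t<4. V (run_difference t i))"
    unfolding V_def base_level_step
    using sum_shifted_pairs[of 10 "\<lambda>y z. (x y - x z)\<^sup>2"] by simp
  also have "\<dots> = V 1 + V 2 + V 3 + V 4"
  proof -
    have "i = 1 \<or> i = 2 \<or> i = 3 \<or> i = 4" using i by auto
    moreover have "(\<Sum>t<4. g t) = g 0 + g 1 + g 2 + g 3" for g :: "nat \<Rightarrow> real"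
      by (simp add: eval_nat_numeral)
    ultimately show ?thesis
      using neg[of 1] neg[of 2] neg[of 3] neg[of 4] by (elim disjE) (simp_all add: run_difference_def)
  qed
  also have "\<dots> = 8 * (\<Sum>p<10. (x p)\<^sup>2) + (\<Sum>p<5. (x p + x (p + 5))\<^sup>2)"
    unfolding V_def shift_variation_1234 x by simp
  also have "\<dots> \<ge> 8 * (\<Sum>p<10. (x p)\<^sup>2)" by (simp add: sum_nonneg)
  finally have "8 * (\<Sum>p<10. (x p)\<^sup>2) \<le> (\<Sum>B<4 * 10. (x (?L 0 B) - x (?L 1 B))\<^sup>2)" .
  moreover have "potb 4 (\<lambda>_. 10) (4 * 10) 2 (cyclic_plan 10 4)" by (rule cyclic_plan_potb) auto
  hence "vec 10 x \<bullet> (information_mat 4 (\<lambda>_. 10) (4 * 10) (cyclic_plan 10 4) i *\<^sub>v vec 10 x)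
    = (\<Sum>B<4 * 10. (x (?L 0 B) - x (?L 1 B))\<^sup>2) / 2"
    unfolding cyclic_plan_def using i by (rule two_run_plan_information_form)
  ultimately show ?thesis by linarith
qed

lemma cyclic_plan_10_E_optimal:
  assumes i: "i \<in> {1..4}"
  shows "E_optimal 4 (\<lambda>_. 10) (4 * 10) 2 (cyclic_plan 10 4) i"
  unfolding E_optimal_def
proof (intro conjI allI impI)
  show conn: "connected_mep 4 (\<lambda>_. 10) (4 * 10) 2 (cyclic_plan 10 4)"
    by (rule cyclic_plan_connected) auto
  let ?C = "\<lambda>R. information_mat 4 (\<lambda>_. 10) (4 * 10) R i"
  fix R assume "connected_mep 4 (\<lambda>_. 10) (4 * 10) 2 R"
  hence "smallest_contrast_eigenvalue (?C R) \<le> 4"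
    using contrast_eigenvalue_upper_bound[of 4 "\<lambda>_. 10" "4 * 10" R i] i by (simp add: connected_mep_def)
  also have "4 \<le> smallest_contrast_eigenvalue (?C (cyclic_plan 10 4))"
  proof -
    \<comment> \<open>Any nonzero contrast serves to show that the smallest eigenvalue is attained.\<close>
    define x :: "nat \<Rightarrow> real" where "x p = of_bool (p = 0) - of_bool (p = 1)" for p
    have "(\<Sum>p<10. x p) = 0" "(\<Sum>p<10. (x p)\<^sup>2) > 0"
      by (simp_all add: x_def eval_nat_numeral)
    then obtain y where y: "(\<Sum>p<10. y p) = 0" "(\<Sum>p<10. (y p)\<^sup>2) > 0"
      "vec 10 y \<bullet> (?C (cyclic_plan 10 4) *\<^sub>v vec 10 y)
        = smallest_contrast_eigenvalue (?C (cyclic_plan 10 4)) * (\<Sum>p<10. (y p)\<^sup>2)"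
      using information_contrast_eigenvalue_rayleigh(2)[of 4 "\<lambda>_. 10" "4 * 10" 2 "cyclic_plan 10 4" i x]
        conn i by (auto simp: connected_mep_def)
    have "4 * (\<Sum>p<10. (y p)\<^sup>2) \<le> smallest_contrast_eigenvalue (?C (cyclic_plan 10 4)) * (\<Sum>p<10. (y p)\<^sup>2)"
      using cyclic_plan_10_form[OF i y(1)] unfolding y(3) .
    thus ?thesis using y(2) by simp
  qed
  finally show "smallest_contrast_eigenvalue (?C R) \<le> smallest_contrast_eigenvalue (?C (cyclic_plan 10 4))" .
qed

section \<open>Existence of the plans\<close>

theorem theorem3p2:
  fixes n :: nat
  assumes "n \<ge> 5"
  shows "(\<exists>A. potb 2 (\<lambda>_. n) (2 * n) 2 A) \<and>
         (\<exists>A. potb 4 (\<lambda>_. n) (4 * n) 2 A) \<and>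
         (\<exists>A. balanced_potb 2 (\<lambda>_. 5) 10 2 A) \<and>
         (\<exists>A. potb 4 (\<lambda>_. 10) 40 2 A \<and> (\<forall>i \<in> {1..4}. E_optimal 4 (\<lambda>_. 10) 40 2 A i))"
proof (intro conjI exI)
  show "potb 2 (\<lambda>_. n) (2 * n) 2 (cyclic_plan n 2)" using assms by (intro cyclic_plan_potb) auto
  show "potb 4 (\<lambda>_. n) (4 * n) 2 (cyclic_plan n 4)" using assms by (intro cyclic_plan_potb) auto
  show "balanced_potb 2 (\<lambda>_. 5) 10 2 (cyclic_plan 5 2)"
    using cyclic_plan_potb[of 2 5] cyclic_plan_connected[of 2 5] cyclic_plan_5_bibd
    by (simp add: balanced_potb_def)
  show "potb 4 (\<lambda>_. 10) 40 2 (cyclic_plan 10 4)" using cyclic_plan_potb[of 4 10] by simp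
  show "\<forall>i\<in>{1..4}. E_optimal 4 (\<lambda>_. 10) 40 2 (cyclic_plan 10 4) i"
    using cyclic_plan_10_E_optimal by simp
qed

end
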